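(* Suppose that $1\leq n<\omega$, $H$ is a nonzero abelian group, and $\vec{x}=\langle x_\alpha\mid\alpha<\omega_n\rangle$ is an ascending sequence of sets. Then there is a nontrivial coherent $n$-family $\Phi=\langle\varphi_b:\bigcap_{i<n}x_{b(i)}\to H^{(\omega_n)}\mid b\in(\omega_n)^n\rangle$. Moreover, if $\vec{e}=\langle e_w\mid w\in\mathrm{Fn}^+(\omega_n)\rangle$ and $C\subseteq\omega_n$ witness that $\vec{x}$ is ascending, then $\Phi$ can be chosen to be supported on $\vec{e}$.
   Context: $H^{(\omega_n)}$ is the direct sum of $\omega_n$ copies of $H$ (finitely supported functions $\omega_n\to H$). Notation: $u =^* v$ for functions means they agree at all but finitely many points of their common domain; $u\subseteq^* v$ means $u\setminus v$ is finite. Sums of functions are taken on the intersection of their domains. Elements of $\delta^n$ are functions $u:n\to\delta$; $u^i$ is the sequence of length $n-1$ obtained by deleting $u(i)$. For a nonempty set $Y$, $\mathrm{Fn}^+(Y)$ is the set of finite partial functions $w$ from $Y$ to $2$ with $w^{-1}\{1\}\neq\emptyset$. Let $\delta$ be a limit ordinal of uncountable cofinality and $\vec{x}=\langle x_\alpha\mid\alpha<\delta\rangle$ sets. $\vec{x}$ respects $w\in\mathrm{Fn}^+(\delta)$ if $d_w:=\bigcap_{\beta\in w^{-1}\{1\}}x_\beta\setminus\bigcup_{\alpha\in w^{-1}\{0\}}x_\alpha$ is infinite. $\vec{x}$ is ascending if there are $\langle e_w\mid w\in\mathrm{Fn}^+(\delta)\rangle$ and a club $C\subseteq\delta$ (said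 to witness ascendingness) with: (a) $e_w$ is a countably infinite subset of $d_w$ if $\vec{x}$ respects $w$, and $e_w=\emptyset$ otherwise; (b) for $\beta\in C$ and finite $a\subseteq\beta$, $x_\beta\not\subseteq^*\bigcup_{\alpha\in a}x_\alpha$; (c) for finite $a\subseteq C$ and $w\in\mathrm{Fn}^+(\min a)$ respected by $\vec{x}$, $e_w\cap\bigcap_{\beta\in a}x_\beta$ is infinite. An $n$-family indexed along $\vec{x}$ with values in an abelian group $G$ is $\Phi=\langle\varphi_a:\bigcap_{i<n}x_{a(i)}\to G\mid a\in\delta^n\rangle$. It is alternating if $\varphi_{a\circ\sigma}=\mathrm{sgn}(\sigma)\varphi_a$ for every permutation $\sigma$ of $n$; coherent if alternating and $\sum_{i<n+1}(-1)^i\varphi_{v^i}=^*0$ for all $v\in\delta^{n+1}$; trivial if ($n=1$) there is $\psi:\bigcup_\alpha x_\alpha\to G$ with $\psi\restriction x_\alpha=^*\varphi_\alpha$ for all $\alpha$, or ($n>1$) there is an alternating $G$-valued $(n-1)$-family $\langle\psi_t\mid t\in\delta^{n-1}\rangle$ with $\varphi_u=^*\sum_{i<n}(-1)^i\psi_{u^i}$ for all $u\in\delta^n$. $\Phi$ is supported on $\vec{e}$ if for all $a\in\delta^n$, $\mathrm{supp}(\varphi_a)\subseteq\bigcup\{e_w\mid w\in\mathrm{Fn}^+(\max_i a(i))\}$. *)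

theory Defs
  imports
    "HOL-Combinatorics.Permutations"
    "HOL-Library.Countable_Set"
    "HOL-Library.Poly_Mapping"
begin

unbundle cardinal_syntax

text \<open>
  An ordinal \<open>\<delta>\<close> is given as a set of elements of a well-ordered type, with the induced order; in
  particular, a type in class \<open>wellorder\<close> represents the order type of its universe.
\<close>

text \<open>
  \<open>is_omega n r\<close>: the well-order \<open>r\<close> is isomorphic to the initial ordinal \<open>\<omega>\<^sub>n\<close>. The witness \<open>s\<close> of
  type \<open>\<omega>\<^sub>n\<close> in the successor clause can be taken on the same type as \<open>r\<close>, as an initial segment.
\<close>
primrec is_omega :: "nat \<Rightarrow> 'i rel \<Rightarrow> bool" where
  "is_omega 0 r \<longleftrightarrow> r =o natLeq"
| "is_omega (Suc n) r \<longleftrightarrow> (\<exists>s :: 'i rel. is_omega n s \<and> r =o cardSuc s)"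

text \<open>Closedness is only tested at points \<open>\<beta>\<close> that are limits of elements of \<open>C\<close>.\<close>
definition club_in :: "'i::wellorder set \<Rightarrow> 'i set \<Rightarrow> bool" where
  "club_in \<delta> C \<longleftrightarrow> C \<subseteq> \<delta>
    \<and> (\<forall>\<gamma>\<in>\<delta>. \<exists>c\<in>C. \<gamma> \<le> c)
    \<and> (\<forall>\<beta>\<in>\<delta>. \<delta> \<inter> {..<\<beta>} \<noteq> {} \<and> (\<forall>\<gamma>\<in>\<delta> \<inter> {..<\<beta>}. \<exists>c\<in>C. \<gamma> < c \<and> c < \<beta>) \<longrightarrow> \<beta> \<in> C)"

definition Fn_plus :: "'i set \<Rightarrow> ('i \<rightharpoonup> bool) set" where
  "Fn_plus Y = {w. finite (dom w) \<and> dom w \<subseteq> Y \<and> w -` {Some True} \<noteq> {}}"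

definition dset :: "('i \<Rightarrow> 'a set) \<Rightarrow> ('i \<rightharpoonup> bool) \<Rightarrow> 'a set" where
  "dset x w = (\<Inter>\<beta>\<in>w -` {Some True}. x \<beta>) - (\<Union>\<alpha>\<in>w -` {Some False}. x \<alpha>)"

definition respects_seq :: "('i \<Rightarrow> 'a set) \<Rightarrow> ('i \<rightharpoonup> bool) \<Rightarrow> bool" where
  "respects_seq x w \<longleftrightarrow> infinite (dset x w)"

definition witness_ascending ::
    "'i::wellorder set \<Rightarrow> ('i \<Rightarrow> 'a set) \<Rightarrow> (('i \<rightharpoonup> bool) \<Rightarrow> 'a set) \<Rightarrow> 'i set \<Rightarrow> bool" where
  "witness_ascending \<delta> x e C \<longleftrightarrow> club_in \<delta> C
    \<and> (\<forall>w\<in>Fn_plus \<delta>. if respects_seq x w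
         then e w \<subseteq> dset x w \<and> countable (e w) \<and> infinite (e w)
         else e w = {})
    \<and> (\<forall>\<beta>\<in>C. \<forall>a. finite a \<and> a \<subseteq> \<delta> \<inter> {..<\<beta>} \<longrightarrow> infinite (x \<beta> - (\<Union>\<alpha>\<in>a. x \<alpha>)))
    \<and> (\<forall>a. finite a \<and> a \<noteq> {} \<and> a \<subseteq> C \<longrightarrow>
         (\<forall>w\<in>Fn_plus (\<delta> \<inter> {..<Min a}). respects_seq x w \<longrightarrow> infinite (e w \<inter> (\<Inter>\<beta>\<in>a. x \<beta>))))"

definition ascending :: "'i::wellorder set \<Rightarrow> ('i \<Rightarrow> 'a set) \<Rightarrow> bool" where
  "ascending \<delta> x \<longleftrightarrow> (\<exists>e C. witness_ascending \<delta> x e C)"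

text \<open>
  Functions \<open>u : n \<rightarrow> \<delta>\<close> are lists of length \<open>n\<close>, so that \<open>u \<circ> \<sigma>\<close> is \<open>permute_list \<sigma> u\<close>.
\<close>
definition tuples :: "'i set \<Rightarrow> nat \<Rightarrow> 'i list set" where
  "tuples \<delta> n = {u. length u = n \<and> set u \<subseteq> \<delta>}"

definition delete :: "nat \<Rightarrow> 'i list \<Rightarrow> 'i list" where
  "delete i u = take i u @ drop (Suc i) u"

text \<open>
  A function on \<open>dm x u\<close> is represented by a total function whose values off \<open>dm x u\<close>
  are irrelevant: every notion below inspects it only on its domain. An \<open>n\<close>-family is then any
  function \<open>\<Phi>\<close> from lists to total functions, of which only \<open>\<Phi> u z\<close> with \<open>u\<close> of length \<open>n\<close> and
  \<open>z \<in> dm x u\<close> matters.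
\<close>
definition dm :: "('i \<Rightarrow> 'a set) \<Rightarrow> 'i list \<Rightarrow> 'a set" where
  "dm x u = (\<Inter>i<length u. x (u ! i))"

definition eq_mod_finite :: "'a set \<Rightarrow> ('a \<Rightarrow> 'g) \<Rightarrow> ('a \<Rightarrow> 'g) \<Rightarrow> bool" where
  "eq_mod_finite D f g \<longleftrightarrow> finite {z\<in>D. f z \<noteq> g z}"

text \<open>\<open>alt_sum \<Phi> v\<close> is the alternating sum of the \<open>\<Phi> (delete i v)\<close> over \<open>i < length v\<close>. If \<open>v\<close> has
  at least two entries, the domains of the summands intersect in \<open>dm x v\<close>.\<close>
definition alt_sum :: "('i list \<Rightarrow> 'a \<Rightarrow> 'g::ab_group_add) \<Rightarrow> 'i list \<Rightarrow> 'a \<Rightarrow> 'g" where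
  "alt_sum \<Phi> v z = (\<Sum>i<length v. if even i then \<Phi> (delete i v) z else - \<Phi> (delete i v) z)"

definition alternating ::
    "'i set \<Rightarrow> ('i \<Rightarrow> 'a set) \<Rightarrow> nat \<Rightarrow> ('i list \<Rightarrow> 'a \<Rightarrow> 'g::ab_group_add) \<Rightarrow> bool" where
  "alternating \<delta> x n \<Phi> \<longleftrightarrow> (\<forall>u\<in>tuples \<delta> n. \<forall>\<sigma>. \<sigma> permutes {..<n} \<longrightarrow>
    (\<forall>z\<in>dm x u. \<Phi> (permute_list \<sigma> u) z = (if evenperm \<sigma> then \<Phi> u z else - \<Phi> u z)))"

definition coherent ::
    "'i set \<Rightarrow> ('i \<Rightarrow> 'a set) \<Rightarrow> nat \<Rightarrow> ('i list \<Rightarrow> 'a \<Rightarrow> 'g::ab_group_add) \<Rightarrow> bool" where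
  "coherent \<delta> x n \<Phi> \<longleftrightarrow> alternating \<delta> x n \<Phi>
    \<and> (\<forall>v\<in>tuples \<delta> (n + 1). eq_mod_finite (dm x v) (alt_sum \<Phi> v) (\<lambda>_. 0))"

text \<open>The notion is only meant for \<open>n \<ge> 1\<close>.\<close>
definition trivial_family ::
    "'i set \<Rightarrow> ('i \<Rightarrow> 'a set) \<Rightarrow> nat \<Rightarrow> ('i list \<Rightarrow> 'a \<Rightarrow> 'g::ab_group_add) \<Rightarrow> bool" where
  "trivial_family \<delta> x n \<Phi> \<longleftrightarrow>
    (if n = 1
     then \<exists>\<psi> :: 'a \<Rightarrow> 'g. \<forall>\<alpha>\<in>\<delta>. eq_mod_finite (x \<alpha>) \<psi> (\<Phi> [\<alpha>])
     else \<exists>\<Psi> :: 'i list \<Rightarrow> 'a \<Rightarrow> 'g. alternating \<delta> x (n - 1) \<Psi>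
       \<and> (\<forall>u\<in>tuples \<delta> n. eq_mod_finite (dm x u) (\<Phi> u) (alt_sum \<Psi> u)))"

definition supported_on ::
    "'i::wellorder set \<Rightarrow> ('i \<Rightarrow> 'a set) \<Rightarrow> nat \<Rightarrow> (('i \<rightharpoonup> bool) \<Rightarrow> 'a set)
      \<Rightarrow> ('i list \<Rightarrow> 'a \<Rightarrow> 'g::ab_group_add) \<Rightarrow> bool" where
  "supported_on \<delta> x n e \<Phi> \<longleftrightarrow> (\<forall>u\<in>tuples \<delta> n.
    {z\<in>dm x u. \<Phi> u z \<noteq> 0} \<subseteq> (\<Union>w\<in>Fn_plus (\<delta> \<inter> {..<Max (set u)}). e w))"

end

(* For n >= 1 the sets are added one at a time along the well-order. A coherent n-family on fewer
   than aleph_n indices is trivial (by induction on n: once a trivialization is fixed below a new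
   index, extending it to that index is a problem in dimension n - 1). So the family phi built below
   a stage d is trivialized by some psi, and it can be extended to d either by psi or by psi minus a
   nontrivial coherent (n-1)-family theta placed in the d-th coordinate of the direct sum; theta
   exists by induction on n whenever d is a limit of cofinality omega_(n-1) of suitable stages, and
   we take the choice whose d-th coordinate is nontrivial. If T trivialized the whole family, there
   would be such a d below which T does not use the coordinate d at all, since the supports lie in
   unions of the countable sets e_w; then T would trivialize the d-th coordinate at stage d. The
   induction starts with 0-families, which are functions that are finitely supported on every x_a,
   and nontrivial when their support is infinite.

   Families are indexed by finite sets, with signs taken from the linear order of the index type; this
   sign order is unrelated to the order in which the indices are enumerated. *)

theory Submission
  imports Defs
begin

section \<open>Families indexed by finite sets\<close>

text \<open>The direct sum takes over the task of a guessing principle. No stage has to anticipate a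
  given trivialization \<open>T\<close>: stage \<open>d\<close> defeats every \<open>T\<close> whose
  values below \<open>d\<close> avoid coordinate \<open>d\<close>, and closing off under the
  coordinates that occur produces such a \<open>d\<close> for each \<open>T\<close>. This works
  because a group element has finitely many nonzero coordinates and because few points matter below
  a stage. The second reason is why a support bound by \<open>hull\<close> is carried through the
  whole induction: without it the points \<open>z\<close> would form a set of arbitrary size. The
  family subtracted at stage \<open>d\<close> lives on the traces of the earlier sets on
  \<open>x d\<close>, so the induction must allow a shrinking ambient set \<open>U\<close>. Its
  index set is the segment below \<open>d\<close>, which may be longer than the initial ordinal of
  the induction hypothesis, so the segment is re-enumerated; this is why the order is a parameter
  instead of that of the type. Finally, the subtracted family must come with coefficients that fit
  into one coordinate. A sum of omega_n copies of \<open>H\<close> splits into omega_n copies of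
  itself, so a single group serves in all dimensions.\<close>

definition sgm :: "nat \<Rightarrow> 'g::ab_group_add \<Rightarrow> 'g" where
  "sgm k g = (if even k then g else - g)"

definition below :: "'i::linorder \<Rightarrow> 'i set \<Rightarrow> nat" where
  "below c F = card {j\<in>F. j < c}"

definition dom_on :: "('i \<Rightarrow> 'a set) \<Rightarrow> 'a set \<Rightarrow> 'i set \<Rightarrow> 'a set" where
  "dom_on x U F = {z\<in>U. \<forall>i\<in>F. z \<in> x i}"

text \<open>The simplicial coboundary. On a singleton it is the value at \<open>{}\<close>, and on
  \<open>{}\<close> it is 0; this fixes what \<open>coh\<close> and \<open>triv\<close> say in
  dimensions 0 and 1.\<close>

definition cob :: "('i::linorder set \<Rightarrow> 'a \<Rightarrow> 'g::ab_group_add) \<Rightarrow> 'i set \<Rightarrow> 'a \<Rightarrow> 'g" where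
  "cob \<phi> F z = (\<Sum>i\<in>F. sgm (below i F) (\<phi> (F - {i}) z))"

text \<open>For \<open>c\<close> outside \<open>H\<close>, this is the restriction of the cochain to
  the link of \<open>c\<close>, with the sign for moving \<open>c\<close> to the front.\<close>

definition cone :: "('i::linorder set \<Rightarrow> 'a \<Rightarrow> 'g::ab_group_add) \<Rightarrow> 'i \<Rightarrow> 'i set \<Rightarrow> 'a \<Rightarrow> 'g" where
  "cone \<phi> c H z = sgm (below c H) (\<phi> (insert c H) z)"

definition fsub :: "'i set \<Rightarrow> nat \<Rightarrow> 'i set set" where
  "fsub I n = {F. finite F \<and> F \<subseteq> I \<and> card F = n}"

text \<open>The ambient set \<open>U\<close> is the domain of the empty index set, which makes \<open>n = 0\<close> meaningful.\<close>
definition coh :: "('i::linorder \<Rightarrow> 'a set) \<Rightarrow> 'a set \<Rightarrow> 'i set \<Rightarrow> nat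
    \<Rightarrow> ('i set \<Rightarrow> 'a \<Rightarrow> 'g::ab_group_add) \<Rightarrow> bool" where
  "coh x U I n \<phi> \<longleftrightarrow> (\<forall>F\<in>fsub I (Suc n). finite {z\<in>dom_on x U F. cob \<phi> F z \<noteq> 0})"

definition triv :: "('i::linorder \<Rightarrow> 'a set) \<Rightarrow> 'a set \<Rightarrow> 'i set \<Rightarrow> nat
    \<Rightarrow> ('i set \<Rightarrow> 'a \<Rightarrow> 'g::ab_group_add) \<Rightarrow> bool" where
  "triv x U I n \<phi> \<longleftrightarrow>
    (\<exists>\<psi>. \<forall>F\<in>fsub I n. finite {z\<in>dom_on x U F. \<phi> F z \<noteq> cob \<psi> F z})"

lemma sgm_sgm [simp]: "sgm a (sgm b g) = sgm (a + b) g"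
  by (auto simp: sgm_def)

lemma sgm_twice [simp]: "sgm (a + a) g = g"
  by (auto simp: sgm_def)

lemma sgm_zero [simp]: "sgm a 0 = 0"
  by (simp add: sgm_def)

lemma sgm_eq_zero_iff [simp]: "sgm a g = 0 \<longleftrightarrow> g = 0"
  by (simp add: sgm_def)

lemma sgm_diff: "sgm a (g - h) = sgm a g - sgm a h"
  by (simp add: sgm_def)

lemma sgm_sum: "sgm a (sum f S) = (\<Sum>i\<in>S. sgm a (f i))"
  by (simp add: sgm_def sum_negf)

lemma sgm_parity: "even (a + b) \<Longrightarrow> sgm a g = sgm b g"
  by (auto simp: sgm_def)

lemma additive_zero:
  fixes p :: "'g::ab_group_add \<Rightarrow> 'h::ab_group_add"
  assumes "\<And>a b. p (a + b) = p a + p b"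
  shows "p 0 = 0"
  using assms[of 0 0] by simp

lemma additive_diff:
  fixes p :: "'g::ab_group_add \<Rightarrow> 'h::ab_group_add"
  assumes "\<And>a b. p (a + b) = p a + p b"
  shows "p (a - b) = p a - p b"
  using assms[of "a - b" b] by (simp add: algebra_simps)

lemma additive_sgm:
  fixes p :: "'g::ab_group_add \<Rightarrow> 'h::ab_group_add"
  assumes "\<And>a b. p (a + b) = p a + p b"
  shows "p (sgm k g) = sgm k (p g)"
  using additive_diff[of p 0 g, OF assms] additive_zero[of p, OF assms] by (simp add: sgm_def)

lemma cob_additive:
  fixes p :: "'g::ab_group_add \<Rightarrow> 'h::ab_group_add"
  assumes "\<And>a b. p (a + b) = p a + p b"
  shows "cob (\<lambda>F z. p (\<phi> F z)) F z = p (cob \<phi> F z)"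
proof -
  have sum: "p (sum f S) = (\<Sum>i\<in>S. p (f i))" for f :: "'i \<Rightarrow> 'g" and S
    by (induction S rule: infinite_finite_induct) (simp_all add: assms additive_zero[of p, OF assms])
  show ?thesis by (simp add: cob_def sum additive_sgm[of p, OF assms])
qed

lemma cob_diff: "cob (\<lambda>F z. \<phi> F z - \<psi> F z) F z = cob \<phi> F z - cob \<psi> F z"
  by (simp add: cob_def sgm_diff sum_subtractf)

lemma cob_cut: "cob (\<lambda>F z. if z \<in> E then \<phi> F z else 0) F z = (if z \<in> E then cob \<phi> F z else 0)"
  by (simp add: cob_def)

lemma cob_cong:
  assumes "\<And>i. i \<in> F \<Longrightarrow> \<phi> (F - {i}) z = \<psi> (F - {i}) z"
  shows "cob \<phi> F z = cob \<psi> F z"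
  using assms by (simp add: cob_def)

lemma below_insert:
  assumes "finite G" "c \<notin> G"
  shows "below i (insert c G) = below i G + (if c < i then 1 else 0)"
proof -
  have "{j \<in> insert c G. j < i} = (if c < i then insert c {j\<in>G. j < i} else {j\<in>G. j < i})"
    by auto
  then show ?thesis using assms by (simp add: below_def)
qed

text \<open>The faces are the one that loses \<open>c\<close> and those that keep it. For a face
  that loses \<open>i\<close>, the point \<open>c\<close> counts in
  \<open>below i (insert c G)\<close> if it precedes \<open>i\<close>, and otherwise
  \<open>i\<close> counts in \<open>below c G\<close>; exactly one of the two happens, hence the
  minus sign. The identity turns every extension problem at \<open>c\<close> into a problem about
  the cone, one dimension lower.\<close>

lemma cob_insert:
  assumes "finite G" "c \<notin> G"
  shows "cob \<phi> (insert c G) z = sgm (below c G) (\<phi> G z - cob (cone \<phi> c) G z)"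
proof -
  have term_i: "sgm (below i (insert c G)) (\<phi> (insert c G - {i}) z)
      = - sgm (below c G) (sgm (below i G) (cone \<phi> c (G - {i}) z))" if "i \<in> G" for i
  proof -
    have ic: "i \<noteq> c" using that assms by auto
    have e: "insert c G - {i} = insert c (G - {i})" using ic by auto
    have "below c G = below c (insert i (G - {i}))" using that by (simp add: insert_absorb)
    also have "\<dots> = below c (G - {i}) + (if i < c then 1 else 0)"
      by (rule below_insert) (use assms in auto)
    finally have "below c G = below c (G - {i}) + (if i < c then 1 else 0)" .
    moreover have "c < i \<longleftrightarrow> \<not> i < c" using ic by auto
    ultimately show ?thesis
      unfolding e cone_def below_insert[OF assms] by (cases "i < c") (simp_all add: sgm_def)
  qed
  have "cob \<phi> (insert c G) z = sgm (below c (insert c G)) (\<phi> (insert c G - {c}) z)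
     + (\<Sum>i\<in>G. sgm (below i (insert c G)) (\<phi> (insert c G - {i}) z))"
    using assms by (simp add: cob_def)
  also have "insert c G - {c} = G" using assms by auto
  also have "below c (insert c G) = below c G" using assms by (simp add: below_insert)
  also have "(\<Sum>i\<in>G. sgm (below i (insert c G)) (\<phi> (insert c G - {i}) z))
      = - sgm (below c G) (cob (cone \<phi> c) G z)"
    by (simp add: term_i sum_negf cob_def sgm_sum cong: sum.cong)
  finally show ?thesis by (simp add: sgm_diff)
qed

lemma triv_cong:
  assumes "\<And>F z. F \<in> fsub I n \<Longrightarrow> z \<in> dom_on x U F \<Longrightarrow> \<phi> F z = \<psi> F z"
  shows "triv x U I n \<phi> \<longleftrightarrow> triv x U I n \<psi>"
proof -
  have "{z\<in>dom_on x U F. \<phi> F z \<noteq> cob \<tau> F z} = {z\<in>dom_on x U F. \<psi> F z \<noteq> cob \<tau> F z}"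
    if "F \<in> fsub I n" for F \<tau> using assms that by auto
  then show ?thesis by (simp add: triv_def cong: ball_cong)
qed

lemma dom_on_insert: "dom_on x U (insert c F) = dom_on x (U \<inter> x c) F"
  by (auto simp: dom_on_def)

section \<open>Recursion along a strict well-order of the index set\<close>

definition swo :: "'i set \<Rightarrow> 'i rel \<Rightarrow> bool" where
  "swo I s \<longleftrightarrow> wf s \<and> trans s \<and> total_on I s \<and> s \<subseteq> I \<times> I"

abbreviation seg :: "'i rel \<Rightarrow> 'i \<Rightarrow> 'i set" where
  "seg s a \<equiv> {b. (b, a) \<in> s}"

lemma swoD:
  assumes "swo I s"
  shows "wf s" "(a, b) \<in> s \<Longrightarrow> (b, c) \<in> s \<Longrightarrow> (a, c) \<in> s" "(a, a) \<notin> s"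
    "a \<in> I \<Longrightarrow> b \<in> I \<Longrightarrow> a \<noteq> b \<Longrightarrow> (a, b) \<notin> s \<Longrightarrow> (b, a) \<in> s"
    "(a, b) \<in> s \<Longrightarrow> a \<in> I" "(a, b) \<in> s \<Longrightarrow> b \<in> I"
  using assms unfolding swo_def by (auto dest: transD simp: total_on_def)

lemma swo_top:
  assumes s: "swo I s" and F: "finite F" "F \<noteq> {}" "F \<subseteq> I"
  shows "\<exists>!c. c \<in> F \<and> F - {c} \<subseteq> seg s c"
proof (rule ex_ex1I)
  show "\<exists>c. c \<in> F \<and> F - {c} \<subseteq> seg s c"
    using F
  proof (induction F rule: finite_ne_induct)
    case (singleton a)
    then show ?case by auto
  next
    case (insert a F)
    then obtain c where c: "c \<in> F" "F - {c} \<subseteq> seg s c" by auto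
    consider "(a, c) \<in> s" | "(c, a) \<in> s"
      using swoD(4)[OF s, of a c] insert c by auto
    then show ?case
    proof cases
      case 1
      then have "insert a F - {c} \<subseteq> seg s c" using c by auto
      then show ?thesis using c by blast
    next
      case 2
      then have "insert a F - {a} \<subseteq> seg s a" using c swoD(2)[OF s] by blast
      then show ?thesis by blast
    qed
  qed
next
  fix c d
  assume "c \<in> F \<and> F - {c} \<subseteq> seg s c" "d \<in> F \<and> F - {d} \<subseteq> seg s d"
  then show "c = d" using swoD(2,3)[OF s] by blast
qed

lemma fsub_top:
  assumes s: "swo I s" and F: "F \<in> fsub I (Suc n)"
  obtains c G where "c \<in> I" "F = insert c G" "c \<notin> G" "G \<in> fsub (seg s c) n"
proof -
  have "finite F" "F \<noteq> {}" "F \<subseteq> I" "card F = Suc n" using F by (auto simp: fsub_def)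
  then obtain c where c: "c \<in> F" "F - {c} \<subseteq> seg s c" using swo_top[OF s, of F] by blast
  show thesis
  proof (rule that[of c "F - {c}"])
    show "F - {c} \<in> fsub (seg s c) n"
      using c \<open>finite F\<close> \<open>card F = Suc n\<close> by (auto simp: fsub_def)
  qed (use c \<open>F \<subseteq> I\<close> in auto)
qed

lemma fsub_seg:
  assumes s: "swo I s" and "c \<in> I" and G: "G \<in> fsub (seg s c) n"
  shows "insert c G \<in> fsub I (Suc n)" "c \<notin> G" "finite G" "G \<in> fsub I n"
proof -
  have "G \<subseteq> seg s c" "finite G" "card G = n" using G by (auto simp: fsub_def)
  moreover from this show "c \<notin> G" using swoD(3)[OF s] by blast
  ultimately show "insert c G \<in> fsub I (Suc n)" "finite G" "G \<in> fsub I n"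
    using swoD(5)[OF s] \<open>c \<in> I\<close> by (auto simp: fsub_def)
qed

text \<open>A finite nonempty set is its top element together with a set below it. A family is
  therefore the same as a choice, for each \<open>c\<close>, of a function on the sets below
  \<open>c\<close>, and such choices can be made by well-founded recursion once \<open>R c\<close>
  looks only at sets up to \<open>c\<close>. The empty set has no top, so nothing is promised about
  its value.\<close>

lemma family_recursion:
  fixes R :: "'i \<Rightarrow> ('i set \<Rightarrow> 'b) \<Rightarrow> bool"
  assumes s: "swo I s"
    and R_cong: "\<And>c \<Phi> \<Phi>'. c \<in> I \<Longrightarrow> (\<And>F. finite F \<Longrightarrow> F \<noteq> {} \<Longrightarrow> F \<subseteq> insert c (seg s c) \<Longrightarrow> \<Phi> F = \<Phi>' F)
      \<Longrightarrow> R c \<Phi> \<Longrightarrow> R c \<Phi>'"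
    and ext: "\<And>c \<Phi>. c \<in> I \<Longrightarrow> (\<And>a. a \<in> seg s c \<Longrightarrow> R a \<Phi>) \<Longrightarrow>
      \<exists>\<Phi>'. (\<forall>F. finite F \<longrightarrow> F \<noteq> {} \<longrightarrow> F \<subseteq> seg s c \<longrightarrow> \<Phi>' F = \<Phi> F) \<and> R c \<Phi>'"
  shows "\<exists>\<Phi>. \<forall>c\<in>I. R c \<Phi>"
proof -
  define top where "top F = (THE c. c \<in> F \<and> F - {c} \<subseteq> seg s c)" for F
  have top_in: "top F \<in> F" if "finite F" "F \<noteq> {}" "F \<subseteq> I" for F
    using theI'[OF swo_top[OF s that]] unfolding top_def by blast
  have top_eq: "top (insert c G) = c" if "finite G" "c \<in> I" "G \<subseteq> seg s c" for c G
    unfolding top_def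
  proof (rule the1_equality[OF swo_top[OF s]])
    show "insert c G \<subseteq> I" using that swoD(5)[OF s] by auto
  qed (use that in auto)
  define fam where "fam f F = f (top F) (F - {top F})" for f :: "'i \<Rightarrow> 'i set \<Rightarrow> 'b" and F
  have segI: "insert c (seg s c) \<subseteq> I" if "c \<in> I" for c
    using that swoD(5)[OF s] by auto
  have fam_cong: "fam f F = fam g F"
    if "finite F" "F \<noteq> {}" "F \<subseteq> B" "B \<subseteq> I" "\<And>a. a \<in> B \<Longrightarrow> f a = g a" for f g F B
    using top_in[of F] that unfolding fam_def by (metis order_trans subsetD)
  define P where "P f c \<rho> \<longleftrightarrow> (c \<in> I \<longrightarrow> R c (fam (f(c := \<rho>))))" for f c \<rho>
  have "\<exists>f. \<forall>c. P f c (f c)"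
  proof (rule dependent_wf_choice[OF swoD(1)[OF s]])
    fix f g :: "'i \<Rightarrow> 'i set \<Rightarrow> 'b" and c r
    assume fg: "\<And>z. (z, c) \<in> s \<Longrightarrow> f z = g z"
    have "fam (f(c := r)) F = fam (g(c := r)) F"
      if "c \<in> I" "finite F" "F \<noteq> {}" "F \<subseteq> insert c (seg s c)" for F
      by (rule fam_cong[OF that(2-4) segI[OF that(1)]]) (use fg in auto)
    then show "P f c r = P g c r"
      unfolding P_def by (metis R_cong)
  next
    fix c f
    assume IH: "\<And>y. (y, c) \<in> s \<Longrightarrow> P f y (f y)"
    show "\<exists>r. P f c r"
    proof (cases "c \<in> I")
      case True
      have "R a (fam f)" if "a \<in> seg s c" for a
        using IH[of a] that swoD(5)[OF s] by (auto simp: P_def)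
      then obtain \<Phi>' where \<Phi>': "\<And>F. finite F \<Longrightarrow> F \<noteq> {} \<Longrightarrow> F \<subseteq> seg s c \<Longrightarrow> \<Phi>' F = fam f F" "R c \<Phi>'"
        using ext[OF True, of "fam f"] by blast
      \<comment> \<open>The function stored at \<open>c\<close> records \<open>\<Phi>'\<close> on
        the sets with top \<open>c\<close>; on sets below \<open>c\<close> the recursion already
        agrees with \<open>\<Phi>'\<close>.\<close>
      have "\<Phi>' F = fam (f(c := \<lambda>H. \<Phi>' (insert c H))) F"
        if F: "finite F" "F \<noteq> {}" "F \<subseteq> insert c (seg s c)" for F
      proof (cases "c \<in> F")
        case True
        then have e: "F = insert c (F - {c})" by auto
        have "top F = c"
          by (subst e, rule top_eq) (use F \<open>c \<in> I\<close> in auto)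
        then show ?thesis using True by (simp add: fam_def insert_absorb)
      next
        case False
        then have sub: "F \<subseteq> seg s c" using F by auto
        have "fam (f(c := \<lambda>H. \<Phi>' (insert c H))) F = fam f F"
          by (rule fam_cong[OF F(1,2) sub]) (use segI[OF True] swoD(3)[OF s] in auto)
        then show ?thesis using \<Phi>'(1)[OF F(1,2) sub] by simp
      qed
      then have "R c (fam (f(c := \<lambda>H. \<Phi>' (insert c H))))"
        by (rule R_cong[OF True _ \<Phi>'(2)])
      then show ?thesis by (auto simp: P_def)
    qed (simp add: P_def)
  qed
  then obtain f where "\<And>c. P f c (f c)" by blast
  then show ?thesis by (auto simp: P_def intro!: exI[of _ "fam f"])
qed

section \<open>Vanishing\<close>

text \<open>By \<open>cob_insert\<close>, new values at sets through \<open>c\<close> solve the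
  problem exactly when their cone \<open>\<theta>\<close> satisfies
  \<open>cob \<theta> G = \<Psi> G - cone \<phi> c G\<close> up to finitely many points. The right
  side is coherent: \<open>\<Psi>\<close> trivializes \<open>\<phi>\<close> at \<open>F\<close>, and
  coherence of \<open>\<phi>\<close> at \<open>insert c F\<close> identifies the coboundary of the
  cone with \<open>\<phi> F\<close>.\<close>

lemma extend_trivialization:
  assumes s: "swo I s" and c: "c \<in> I" and n: "n \<ge> 1"
    and coh: "coh x U I (Suc n) (\<phi> :: 'i::linorder set \<Rightarrow> 'a \<Rightarrow> 'g::ab_group_add)"
    and \<Psi>: "\<And>F. F \<in> fsub (seg s c) (Suc n) \<Longrightarrow> finite {z\<in>dom_on x U F. \<phi> F z \<noteq> cob \<Psi> F z}"
    and triv: "\<And>U \<chi>. coh x U (seg s c) n (\<chi> :: 'i set \<Rightarrow> 'a \<Rightarrow> 'g) \<Longrightarrow> triv x U (seg s c) n \<chi>"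
  shows "\<exists>\<Psi>'. (\<forall>F. c \<notin> F \<longrightarrow> \<Psi>' F = \<Psi> F) \<and>
    (\<forall>G\<in>fsub (seg s c) n. finite {z\<in>dom_on x U (insert c G). \<phi> (insert c G) z \<noteq> cob \<Psi>' (insert c G) z})"
proof -
  define \<chi> where "\<chi> G z = \<Psi> G z - cone \<phi> c G z" for G z
  have "coh x (U \<inter> x c) (seg s c) n \<chi>"
    unfolding coh_def
  proof
    fix F assume F: "F \<in> fsub (seg s c) (Suc n)"
    note F' = fsub_seg[OF s c F]
    have "cob \<chi> F z = 0" if "\<phi> F z = cob \<Psi> F z" "cob \<phi> (insert c F) z = 0" for z
    proof -
      have "cob (cone \<phi> c) F z = \<phi> F z"
        using that(2) by (simp add: cob_insert[OF F'(3,2)])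
      then show ?thesis using that(1) by (simp add: \<chi>_def[abs_def] cob_diff)
    qed
    then have "{z\<in>dom_on x (U \<inter> x c) F. cob \<chi> F z \<noteq> 0}
        \<subseteq> {z\<in>dom_on x U F. \<phi> F z \<noteq> cob \<Psi> F z} \<union> {z\<in>dom_on x U (insert c F). cob \<phi> (insert c F) z \<noteq> 0}"
      by (auto simp: dom_on_def)
    moreover have "finite {z\<in>dom_on x U (insert c F). cob \<phi> (insert c F) z \<noteq> 0}"
      using coh F'(1) by (simp add: coh_def)
    ultimately show "finite {z\<in>dom_on x (U \<inter> x c) F. cob \<chi> F z \<noteq> 0}"
      using \<Psi>[OF F] finite_subset by blast
  qed
  then have "triv x (U \<inter> x c) (seg s c) n \<chi>" by (rule triv)
  then obtain \<theta> where \<theta>: "\<And>G. G \<in> fsub (seg s c) n \<Longrightarrow> finite {z\<in>dom_on x (U \<inter> x c) G. \<chi> G z \<noteq> cob \<theta> G z}"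
    unfolding triv_def by blast
  \<comment> \<open>The sign is its own inverse, so the cone of \<open>\<Psi>'\<close> at
    \<open>c\<close> is \<open>\<theta>\<close>.\<close>
  define \<Psi>' where "\<Psi>' F z = (if c \<in> F then sgm (below c (F - {c})) (\<theta> (F - {c}) z) else \<Psi> F z)" for F z
  have "finite {z\<in>dom_on x U (insert c G). \<phi> (insert c G) z \<noteq> cob \<Psi>' (insert c G) z}"
    if G: "G \<in> fsub (seg s c) n" for G
  proof -
    note G' = fsub_seg[OF s c G]
    have "\<phi> (insert c G) z = cob \<Psi>' (insert c G) z" if "\<chi> G z = cob \<theta> G z" for z
    proof -
      have "cob (cone \<Psi>' c) G z = cob \<theta> G z"
        by (rule cob_cong) (use G'(2) in \<open>simp add: cone_def \<Psi>'_def\<close>)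
      moreover have "\<phi> (insert c G) z = sgm (below c G) (cone \<phi> c G z)"
        by (simp add: cone_def)
      moreover have "cone \<phi> c G z = \<Psi> G z - cob \<theta> G z"
        using that by (simp add: \<chi>_def algebra_simps)
      ultimately show ?thesis using G'(2)
        by (simp add: cob_insert[OF G'(3,2)] \<Psi>'_def)
    qed
    then have "{z\<in>dom_on x U (insert c G). \<phi> (insert c G) z \<noteq> cob \<Psi>' (insert c G) z}
        \<subseteq> {z\<in>dom_on x (U \<inter> x c) G. \<chi> G z \<noteq> cob \<theta> G z}"
      by (auto simp: dom_on_insert)
    then show ?thesis using \<theta>[OF G] finite_subset by blast
  qed
  then show ?thesis by (intro exI[of _ \<Psi>']) (auto simp: \<Psi>'_def)
qed

text \<open>Vanishing in dimension \<open>n\<close> on all proper initial segments gives vanishing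
  in dimension \<open>n + 1\<close> on the whole set. The condition \<open>n \<ge> 1\<close> keeps
  the faces of \<open>insert c G\<close>, which have \<open>n\<close> elements, nonempty, so that
  \<open>family_recursion\<close> preserves their values.\<close>

lemma triv_step:
  assumes s: "swo I s" and n: "n \<ge> 1"
    and triv: "\<And>c U \<chi>. c \<in> I \<Longrightarrow> coh x U (seg s c) n (\<chi> :: 'i::linorder set \<Rightarrow> 'a \<Rightarrow> 'g::ab_group_add)
      \<Longrightarrow> triv x U (seg s c) n \<chi>"
    and coh: "coh x U I (Suc n) (\<phi> :: 'i set \<Rightarrow> 'a \<Rightarrow> 'g)"
  shows "triv x U I (Suc n) \<phi>"
proof -
  define R where "R c \<Psi> \<longleftrightarrow>
    (\<forall>G\<in>fsub (seg s c) n. finite {z\<in>dom_on x U (insert c G). \<phi> (insert c G) z \<noteq> cob \<Psi> (insert c G) z})"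
    for c and \<Psi> :: "'i set \<Rightarrow> 'a \<Rightarrow> 'g"
  have "\<exists>\<Psi>. \<forall>c\<in>I. R c \<Psi>"
  proof (rule family_recursion[OF s])
    fix c and \<Psi> \<Psi>' :: "'i set \<Rightarrow> 'a \<Rightarrow> 'g"
    assume c: "c \<in> I" and eq: "\<And>F. finite F \<Longrightarrow> F \<noteq> {} \<Longrightarrow> F \<subseteq> insert c (seg s c) \<Longrightarrow> \<Psi> F = \<Psi>' F"
      and R: "R c \<Psi>"
    have "cob \<Psi> (insert c G) z = cob \<Psi>' (insert c G) z" if G: "G \<in> fsub (seg s c) n" for G z
    proof (rule cob_cong)
      fix i assume i: "i \<in> insert c G"
      note G' = fsub_seg[OF s c G]
      have "card (insert c G - {i}) = n" using G'(1) i by (auto simp: fsub_def)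
      moreover have sub: "insert c G - {i} \<subseteq> insert c (seg s c)" using G by (auto simp: fsub_def)
      ultimately have "insert c G - {i} \<noteq> {}" using n by (metis card.empty not_one_le_zero)
      then show "\<Psi> (insert c G - {i}) z = \<Psi>' (insert c G - {i}) z"
        using eq[of "insert c G - {i}"] G'(3) sub by simp
    qed
    then show "R c \<Psi>'" using R by (simp add: R_def)
  next
    fix c and \<Psi> :: "'i set \<Rightarrow> 'a \<Rightarrow> 'g"
    assume c: "c \<in> I" and R: "\<And>a. a \<in> seg s c \<Longrightarrow> R a \<Psi>"
    have "finite {z\<in>dom_on x U F. \<phi> F z \<noteq> cob \<Psi> F z}" if "F \<in> fsub (seg s c) (Suc n)" for F
    proof -
      have "F \<in> fsub I (Suc n)" using that swoD(5)[OF s] by (auto simp: fsub_def)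
      then obtain a G where a: "a \<in> I" "F = insert a G" "a \<notin> G" "G \<in> fsub (seg s a) n"
        by (rule fsub_top[OF s])
      then have "a \<in> seg s c" using that by (auto simp: fsub_def)
      then show ?thesis using R a by (simp add: R_def)
    qed
    then obtain \<Psi>' where \<Psi>': "\<And>F. c \<notin> F \<Longrightarrow> \<Psi>' F = \<Psi> F" "R c \<Psi>'"
      using extend_trivialization[OF s c n coh _ triv[OF c], of \<Psi>] unfolding R_def by blast
    moreover have "c \<notin> seg s c" using swoD(3)[OF s] by simp
    ultimately have "\<Psi>' F = \<Psi> F" if "F \<subseteq> seg s c" for F using that by blast
    then show "\<exists>\<Psi>'. (\<forall>F. finite F \<longrightarrow> F \<noteq> {} \<longrightarrow> F \<subseteq> seg s c \<longrightarrow> \<Psi>' F = \<Psi> F) \<and> R c \<Psi>'"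
      using \<Psi>'(2) by blast
  qed
  then obtain \<Psi> where \<Psi>: "\<And>c. c \<in> I \<Longrightarrow> R c \<Psi>" by blast
  have "finite {z\<in>dom_on x U F. \<phi> F z \<noteq> cob \<Psi> F z}" if F: "F \<in> fsub I (Suc n)" for F
  proof -
    obtain c G where "c \<in> I" "F = insert c G" "G \<in> fsub (seg s c) n" by (rule fsub_top[OF s F])
    then show ?thesis using \<Psi>[of c] by (simp add: R_def)
  qed
  then show ?thesis by (auto simp: triv_def)
qed

lemma below_single: "below i {i} = 0" "below i {} = 0"
proof -
  have "{j \<in> {i}. j < i} = {}" by auto
  then show "below i {i} = 0" unfolding below_def by simp
qed (simp add: below_def)

text \<open>Each point takes its value from the first set containing it, in an enumeration of
  \<open>I\<close> by natural numbers. On \<open>x i\<close> an error at \<open>z\<close> forces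
  incoherence at \<open>z\<close> between \<open>i\<close> and one of the finitely many earlier
  indices.\<close>

lemma triv_countable_1:
  assumes "countable I" and coh: "coh x U I 1 (\<phi> :: 'i::linorder set \<Rightarrow> 'a \<Rightarrow> 'g::ab_group_add)"
  shows "triv x U I 1 \<phi>"
proof -
  obtain f :: "'i \<Rightarrow> nat" where f: "inj_on f I" using assms(1) by (auto simp: countable_def)
  define first where "first z = arg_min_on f {i\<in>I. z \<in> x i}" for z
  define \<psi> where "\<psi> F z = \<phi> {first z} z" for F :: "'i set" and z
  have first: "first z \<in> I" "z \<in> x (first z)" "f (first z) \<le> f i" if "i \<in> I" "z \<in> x i" for i z
  proof -
    have "is_arg_min f (\<lambda>i. i \<in> {i\<in>I. z \<in> x i}) (first z)"
      unfolding first_def arg_min_on_def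
      by (rule is_arg_min_arg_min_nat[of _ i]) (use that in auto)
    then show "first z \<in> I" "z \<in> x (first z)" "f (first z) \<le> f i"
      using that by (auto simp: is_arg_min_def not_less)
  qed
  have "finite {z\<in>dom_on x U F. \<phi> F z \<noteq> cob \<psi> F z}" if F: "F \<in> fsub I 1" for F
  proof -
    obtain i where i: "F = {i}" "i \<in> I" using F by (auto simp: fsub_def card_1_singleton_iff)
    define J where "J = {j\<in>I. f j < f i}"
    have "finite J" using finite_imageD[of f J] f inj_on_subset[of f I J]
      by (auto simp: J_def intro: finite_subset[of _ "{..<f i}"])
    have "\<phi> {i} z = cob \<psi> {i} z"
      if z: "z \<in> U" "z \<in> x i" and no: "\<forall>j\<in>J. z \<in> x j \<longrightarrow> cob \<phi> {i, j} z = 0" for z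
    proof (cases "first z = i")
      case False
      then have J: "first z \<in> J"
        using first[OF i(2) z(2)] f i(2) by (auto simp: J_def inj_on_def order.order_iff_strict)
      then have "cob \<phi> {i, first z} z = 0" using no first[OF i(2) z(2)] by auto
      then have "\<phi> {first z} z - cob (cone \<phi> i) {first z} z = 0"
        using cob_insert[of "{first z}" i \<phi> z] False by auto
      moreover have "cob (cone \<phi> i) {first z} z = \<phi> {i} z"
        by (simp add: cob_def cone_def below_single sgm_def)
      ultimately show ?thesis by (simp add: cob_def \<psi>_def below_single sgm_def)
    qed (simp add: cob_def \<psi>_def below_single sgm_def)
    then have "{z\<in>dom_on x U F. \<phi> F z \<noteq> cob \<psi> F z}
        \<subseteq> (\<Union>j\<in>J. {z\<in>dom_on x U {i, j}. cob \<phi> {i, j} z \<noteq> 0})"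
      by (auto simp: i dom_on_def)
    moreover have "finite {z\<in>dom_on x U {i, j}. cob \<phi> {i, j} z \<noteq> 0}" if "j \<in> J" for j
    proof -
      have "j \<noteq> i" "j \<in> I" using that by (auto simp: J_def)
      then have "{i, j} \<in> fsub I (Suc 1)" using i(2) by (simp add: fsub_def)
      then show ?thesis using coh unfolding coh_def by blast
    qed
    ultimately show ?thesis using \<open>finite J\<close> finite_subset by blast
  qed
  then show ?thesis by (auto simp: triv_def)
qed

lemma swo_exists: "\<exists>s. swo I s"
proof -
  obtain r where r: "well_order_on I r" using well_order_on by blast
  have "swo I (r - Id)"
    using r unfolding swo_def well_order_on_def linear_order_on_def partial_order_on_def preorder_on_def
      refl_on_def total_on_def
    by (auto intro: trans_diff_Id)
  then show ?thesis by blast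
qed

text \<open>Initial segments of a countable set are countable in any well-order, so
  \<open>triv_step\<close> raises the dimension without changing the size.\<close>

lemma triv_countable:
  assumes "countable I" "n \<ge> 1" "coh x U I n (\<phi> :: 'i::linorder set \<Rightarrow> 'a \<Rightarrow> 'g::ab_group_add)"
  shows "triv x U I n \<phi>"
  using assms(2,1,3)
proof (induction n arbitrary: I U \<phi> rule: nat_induct_at_least)
  case base
  then show ?case using triv_countable_1 by auto
next
  case (Suc n)
  obtain s where s: "swo I s" using swo_exists by blast
  have "countable (seg s c)" for c
    by (rule countable_subset[OF _ Suc.prems(1)]) (use swoD(5)[OF s] in auto)
  then show ?case by (intro triv_step[OF s \<open>1 \<le> n\<close> _ Suc.prems(2)] Suc.IH)
qed

section \<open>Sets smaller than a given aleph\<close>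

lemma natLeq_infinite:
  assumes "natLeq \<le>o |A|" shows "infinite A"
proof
  assume "finite A"
  then have "|A| <o natLeq" by (simp only: finite_iff_ordLess_natLeq)
  then show False using assms not_ordLess_ordLeq by blast
qed

text \<open>\<open>k m\<close> represents aleph_m for \<open>m \<le> N\<close>. All these relations
  live on one type, matching the shape of the witnesses in \<open>is_omega\<close>.\<close>

locale alephs =
  fixes k :: "nat \<Rightarrow> 'k rel" and N :: nat
  assumes k_0: "k 0 =o natLeq"
    and k_Suc: "m < N \<Longrightarrow> k (Suc m) =o cardSuc (k m)"
begin

text \<open>\<open>sm n A\<close> says that \<open>A\<close> has fewer than \<open>\<aleph>\<^sub>n\<close> elements.\<close>
definition sm :: "nat \<Rightarrow> 'b set \<Rightarrow> bool" where
  "sm n A \<longleftrightarrow> (case n of 0 \<Rightarrow> finite A | Suc m \<Rightarrow> |A| \<le>o k m)"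

lemma sm_0 [simp]: "sm 0 A \<longleftrightarrow> finite A"
  by (simp add: sm_def)

lemma sm_Suc: "sm (Suc m) A \<longleftrightarrow> |A| \<le>o k m"
  by (simp add: sm_def)

lemma card_k: "m \<le> N \<Longrightarrow> Card_order (k m)"
proof (induction m)
  case 0
  then show ?case using k_0 Card_order_ordIso natLeq_Card_order by blast
next
  case (Suc m)
  then show ?case using k_Suc[of m] Card_order_ordIso cardSuc_Card_order by (metis Suc_le_lessD Suc_leD)
qed

lemma natLeq_k: "m \<le> N \<Longrightarrow> natLeq \<le>o k m"
proof (induction m)
  case 0
  then show ?case using k_0 ordIso_iff_ordLeq by blast
next
  case (Suc m)
  then have "k m \<le>o cardSuc (k m)" by (simp add: card_k cardSuc_ordLeq)
  also have "cardSuc (k m) =o k (Suc m)" using Suc k_Suc[of m] ordIso_symmetric by auto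
  finally show ?case using Suc ordLeq_transitive by fastforce
qed

lemma infinite_k:
  assumes "m \<le> N" shows "infinite (Field (k m))"
proof -
  have "natLeq \<le>o k m" by (rule natLeq_k[OF assms])
  also have "k m =o |Field (k m)|"
    using card_of_Field_ordIso[OF card_k[OF assms]] ordIso_symmetric by blast
  finally show ?thesis by (rule natLeq_infinite)
qed

lemma sm_subset: "sm n A \<Longrightarrow> B \<subseteq> A \<Longrightarrow> sm n B"
  by (cases n) (simp add: finite_subset, metis card_of_mono1 ordLeq_transitive sm_Suc)

lemma sm_image: "sm n A \<Longrightarrow> sm n (f ` A)"
  by (cases n) (simp, metis card_of_image ordLeq_transitive sm_Suc)

text \<open>This is regularity of aleph_n: for \<open>n = 0\<close> a finite union of finite sets,
  otherwise a union of at most aleph_m sets of size at most aleph_m, where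
  \<open>n = Suc m\<close>.\<close>

lemma sm_UN:
  assumes "n \<le> Suc N" "sm n A" "\<And>a. a \<in> A \<Longrightarrow> sm n (F a)"
  shows "sm n (\<Union>a\<in>A. F a)"
proof (cases n)
  case (Suc m)
  then have "m \<le> N" using assms by simp
  have "|\<Union>a\<in>A. F a| \<le>o k m"
    by (rule card_of_UNION_ordLeq_infinite_Field[OF infinite_k[OF \<open>m \<le> N\<close>] card_k[OF \<open>m \<le> N\<close>]])
      (use assms Suc in \<open>auto simp: sm_Suc\<close>)
  then show ?thesis using Suc by (simp add: sm_Suc)
qed (use assms in auto)

lemma countable_sm:
  assumes "n \<le> N" "countable A" shows "sm (Suc n) A"
proof -
  have "|A| \<le>o |UNIV :: nat set|" using assms(2) unfolding countable_def card_of_ordLeq[symmetric] by auto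
  also have "|UNIV :: nat set| =o natLeq" by (rule card_of_nat)
  also have "natLeq \<le>o k n" by (rule natLeq_k[OF assms(1)])
  finally show ?thesis by (simp add: sm_Suc)
qed

lemma finite_sm:
  assumes "n \<le> Suc N" "finite A" shows "sm n A"
  using assms countable_sm[OF _ countable_finite[OF assms(2)]] by (cases n) simp_all

lemma ordLess_k_sm:
  assumes "n \<le> N" "|A| <o k n" shows "sm n A"
proof (cases n)
  case 0
  then have "|A| <o k 0" using assms(2) by simp
  then have "|A| <o natLeq" using k_0 ordLess_ordIso_trans by blast
  then have "finite A" by (simp only: finite_iff_ordLess_natLeq)
  then show ?thesis using 0 by simp
next
  case (Suc m)
  then have "|A| <o k (Suc m)" "m < N" using assms by simp_all
  then have "|A| <o cardSuc (k m)" using k_Suc[of m] ordLess_ordIso_trans by blast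
  moreover have "Card_order (k m)" by (rule card_k) (use \<open>m < N\<close> in simp)
  ultimately have "|A| \<le>o k m" using cardSuc_ordLeq_ordLess card_of_Card_order by blast
  then show ?thesis using Suc by (simp add: sm_Suc)
qed

lemma not_sm:
  assumes "n \<le> N" "k n \<le>o |A|" shows "\<not> sm n A"
proof (cases n)
  case 0
  have "natLeq \<le>o k n" by (rule natLeq_k[OF assms(1)])
  also note assms(2)
  finally have "infinite A" by (rule natLeq_infinite)
  then show ?thesis using 0 by simp
next
  case (Suc m)
  then have m: "m < N" using assms by simp
  have "k m <o cardSuc (k m)" by (rule cardSuc_greater[OF card_k]) (use m in simp)
  also have "cardSuc (k m) =o k n" using k_Suc[OF m] Suc ordIso_symmetric by blast
  also have "k n \<le>o |A|" by (rule assms(2))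
  finally have "k m <o |A|" .
  then have "\<not> |A| \<le>o k m" using not_ordLess_ordLeq by blast
  then show ?thesis using Suc by (simp add: sm_Suc)
qed

text \<open>The order of the cardinal \<open>k n\<close> is pulled back along an injection of
  \<open>A\<close>; its proper initial segments are smaller than the cardinal.\<close>

lemma sm_order:
  assumes n: "n \<le> N" and A: "sm (Suc n) A"
  shows "\<exists>s. swo A s \<and> (\<forall>a. sm n (seg s a))"
proof -
  have "|A| \<le>o k n" using A by (simp add: sm_Suc)
  also have "k n =o |Field (k n)|" using card_of_Field_ordIso[OF card_k[OF n]] ordIso_symmetric by blast
  finally have "|A| \<le>o |Field (k n)|" .
  then obtain f where f: "inj_on f A" "f ` A \<subseteq> Field (k n)"
    unfolding card_of_ordLeq[symmetric] by blast
  define s where "s = {(a, b). a \<in> A \<and> b \<in> A \<and> (f a, f b) \<in> k n - Id}"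
  have wo: "Well_order (k n)" using card_k[OF n] by (simp add: card_order_on_def)
  then have wf: "wf (k n - Id)" and tr: "trans (k n - Id)" and tot: "total_on (Field (k n)) (k n)"
    by (auto simp: well_order_on_def linear_order_on_def partial_order_on_def preorder_on_def
        intro: trans_diff_Id)
  have "swo A s"
    unfolding swo_def
  proof (intro conjI)
    show "wf s" by (rule wf_subset[OF wf_inv_image[OF wf, of f]]) (auto simp: s_def inv_image_def)
    show "trans s" using tr unfolding trans_def s_def by blast
    show "total_on A s" using f tot unfolding total_on_def s_def inj_on_def by blast
  qed (auto simp: s_def)
  moreover have "sm n (seg s a)" for a
  proof (cases "a \<in> A")
    case True
    have "inj_on f (seg s a)" "f ` seg s a \<subseteq> underS (k n) (f a)"
      using f by (auto simp: s_def underS_def inj_on_def)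
    then have "|seg s a| \<le>o |underS (k n) (f a)|" unfolding card_of_ordLeq[symmetric] by blast
    moreover have "|underS (k n) (f a)| <o k n"
      using card_of_underS[OF card_k[OF n]] f True by blast
    ultimately show ?thesis using ordLess_k_sm[OF n] ordLeq_ordLess_trans by blast
  next
    case False
    then have "seg s a = {}" by (auto simp: s_def)
    then show ?thesis using n by (simp add: finite_sm)
  qed
  ultimately show ?thesis by blast
qed

lemma subset_exactly:
  assumes n: "n \<le> N" and A: "\<not> sm (Suc n) A"
  obtains X where "X \<subseteq> A" "sm (Suc n) X" "\<not> sm n X"
proof -
  have "k n \<le>o |A|"
    using A card_k[OF n] by (metis card_of_Well_order card_order_on_well_order_on
        not_ordLeq_iff_ordLess ordLess_imp_ordLeq sm_Suc)
  then have "|Field (k n)| \<le>o |A|"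
    using card_of_Field_ordIso[OF card_k[OF n]] ordIso_ordLeq_trans by blast
  then obtain g where g: "inj_on g (Field (k n))" "g ` Field (k n) \<subseteq> A"
    unfolding card_of_ordLeq[symmetric] by blast
  have iso: "k n =o |g ` Field (k n)|"
    using g(1) card_of_Field_ordIso[OF card_k[OF n]] card_of_ordIsoI[of g "Field (k n)"]
    by (meson bij_betw_imageI ordIso_symmetric ordIso_transitive)
  show thesis
  proof (rule that[OF g(2)])
    show "sm (Suc n) (g ` Field (k n))" using iso ordIso_symmetric ordIso_iff_ordLeq by (auto simp: sm_Suc)
    show "\<not> sm n (g ` Field (k n))" using not_sm[OF n] iso ordIso_iff_ordLeq by blast
  qed
qed

lemma sm_fsub:
  assumes n: "n \<le> N" and A: "sm (Suc n) A"
  shows "sm (Suc n) (fsub A j)"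
proof (induction j)
  case 0
  have "fsub A 0 = {{}}" by (auto simp: fsub_def)
  then show ?case using n by (simp add: finite_sm)
next
  case (Suc j)
  have "fsub A (Suc j) \<subseteq> (\<Union>a\<in>A. insert a ` fsub A j)"
  proof
    fix F assume F: "F \<in> fsub A (Suc j)"
    then have "F \<noteq> {}" by (auto simp: fsub_def)
    then obtain a where "a \<in> F" by blast
    then have "F = insert a (F - {a})" "F - {a} \<in> fsub A j" "a \<in> A" using F by (auto simp: fsub_def)
    then show "F \<in> (\<Union>a\<in>A. insert a ` fsub A j)" by blast
  qed
  moreover have "sm (Suc n) (\<Union>a\<in>A. insert a ` fsub A j)"
    using n A Suc by (intro sm_UN sm_image) auto
  ultimately show ?case using sm_subset by blast
qed

lemma sm_Fpow:
  assumes n: "n \<le> N" and A: "sm (Suc n) A"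
  shows "sm (Suc n) {F. finite F \<and> F \<subseteq> A}"
proof -
  have "{F. finite F \<and> F \<subseteq> A} = (\<Union>j. fsub A j)" by (auto simp: fsub_def)
  moreover have "sm (Suc n) (\<Union>j. fsub A j)"
    by (rule sm_UN) (use n sm_fsub[OF n A] countable_sm[OF n, of "UNIV :: nat set"] in auto)
  ultimately show ?thesis by simp
qed

text \<open>In the order from \<open>sm_order\<close> initial segments are one aleph smaller, while
  \<open>triv_step\<close> asks for one dimension less. Size and dimension thus descend together,
  until the set is countable and every positive dimension is settled.\<close>

lemma sm_triv:
  assumes "m \<le> N" "sm (Suc m) I" "n \<ge> Suc m"
    and "coh x U I n (\<phi> :: 'i::linorder set \<Rightarrow> 'a \<Rightarrow> 'g::ab_group_add)"
  shows "triv x U I n \<phi>"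
  using assms
proof (induction m arbitrary: I n U \<phi>)
  case 0
  have "|I| \<le>o |UNIV :: nat set|"
    using 0 k_0 card_of_nat ordIso_symmetric ordLeq_ordIso_trans by (metis sm_Suc)
  then have "countable I" unfolding countable_def card_of_ordLeq[symmetric] by auto
  then show ?case using triv_countable 0 by auto
next
  case (Suc m)
  obtain s where s: "swo I s" "\<And>a. sm (Suc m) (seg s a)"
    using sm_order[OF Suc.prems(1,2)] by blast
  obtain n' where n': "n = Suc n'" "n' \<ge> Suc m" using Suc.prems(3) by (cases n) auto
  show ?case unfolding n'(1)
    by (rule triv_step[OF s(1)]) (use Suc s n' in auto)
qed

end

section \<open>Stages of cofinality \<open>\<omega>\<^sub>n\<close>\<close>

context alephs
begin

lemma sm_insert:
  assumes "n \<le> Suc N" "sm n A" shows "sm n (insert a A)"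
proof -
  have "insert a A = (\<Union>b\<in>{True, False}. if b then {a} else A)" by auto
  moreover have "sm n (\<Union>b\<in>{True, False}. if b then {a} else A)"
    by (rule sm_UN) (use assms finite_sm[of n "{a}"] finite_sm[of n "{True, False}"] in auto)
  ultimately show ?thesis by simp
qed

end

section \<open>Supports, ladders and the choice of a stage\<close>

text \<open>A point of the hull comes from one finite \<open>b\<close>. Below a limit it therefore
  already belongs to the hull of an earlier segment, and the hull of a set of size at most aleph_n
  is not larger than that.\<close>

definition hull :: "('i set \<Rightarrow> 'a set) \<Rightarrow> 'i set \<Rightarrow> 'a set" where
  "hull \<epsilon> A = \<Union> (\<epsilon> ` {b. finite b \<and> b \<subseteq> A})"

lemma hull_mono: "A \<subseteq> B \<Longrightarrow> hull \<epsilon> A \<subseteq> hull \<epsilon> B"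
  unfolding hull_def by (intro Union_mono image_mono) auto

text \<open>\<open>pr d\<close> and \<open>em d\<close> are the projections to and the embeddings of the summands when the direct sum
  of \<open>\<omega>\<^sub>n\<close> copies of \<open>H\<close> is split into \<open>\<omega>\<^sub>n\<close> copies of itself.\<close>
locale ladders = alephs k N for k :: "nat \<Rightarrow> 'k rel" and N :: nat +
  fixes x :: "'i::linorder \<Rightarrow> 'a set"
    and \<epsilon> :: "'i set \<Rightarrow> 'a set"
    and pr em :: "'i \<Rightarrow> 'g::ab_group_add \<Rightarrow> 'g"
  assumes countable_\<epsilon>: "finite b \<Longrightarrow> countable (\<epsilon> b)"
    and pr_add: "pr d (g + h) = pr d g + pr d h"
    and em_add: "em d (g + h) = em d g + em d h"
    and pr_em: "pr d (em d g) = g"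
    and finite_pr: "finite {d. pr d g \<noteq> 0}"
    and nonzero: "\<exists>g :: 'g. g \<noteq> 0"
begin

text \<open>The order \<open>r\<close> on \<open>I\<close> has type \<open>\<omega>\<^sub>n\<close> and \<open>K\<close> is a club in it. The last clause is what remains of
  conditions (b) and (c) of ascendingness: single points suffice. In this form it passes from \<open>U\<close> to
  \<open>U \<inter> x \<delta>\<close>, by adding \<open>\<delta>\<close> to \<open>a\<close>.\<close>
definition ladder :: "nat \<Rightarrow> 'i set \<Rightarrow> 'i rel \<Rightarrow> 'i set \<Rightarrow> 'a set \<Rightarrow> bool" where
  "ladder n I r K U \<longleftrightarrow> swo I r \<and> (\<forall>c. sm n (seg r c)) \<and> K \<subseteq> I
    \<and> (\<forall>B\<subseteq>I. sm n B \<longrightarrow> (\<exists>\<beta>\<in>K. B \<subseteq> seg r \<beta>))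
    \<and> (\<forall>\<beta>\<in>I. seg r \<beta> \<noteq> {} \<longrightarrow> (\<forall>\<alpha>\<in>seg r \<beta>. \<exists>c\<in>K. (\<alpha>, c) \<in> r \<and> (c, \<beta>) \<in> r) \<longrightarrow> \<beta> \<in> K)
    \<and> (\<forall>\<beta>\<in>K. \<forall>b a. finite b \<longrightarrow> b \<subseteq> seg r \<beta> \<longrightarrow> finite a \<longrightarrow> a \<subseteq> K \<longrightarrow> (\<forall>\<gamma>\<in>a. (\<beta>, \<gamma>) \<in> r)
        \<longrightarrow> (\<exists>z\<in>\<epsilon> (insert \<beta> b) \<inter> U. z \<in> x \<beta> \<and> (\<forall>\<gamma>\<in>a. z \<in> x \<gamma>) \<and> (\<forall>\<alpha>\<in>b. z \<notin> x \<alpha>)))"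

lemma ladderD:
  assumes "ladder n I r K U"
  shows "swo I r" "sm n (seg r c)" "K \<subseteq> I"
    "B \<subseteq> I \<Longrightarrow> sm n B \<Longrightarrow> \<exists>\<beta>\<in>K. B \<subseteq> seg r \<beta>"
    "\<beta> \<in> I \<Longrightarrow> seg r \<beta> \<noteq> {} \<Longrightarrow> (\<And>\<alpha>. \<alpha> \<in> seg r \<beta> \<Longrightarrow> \<exists>c\<in>K. (\<alpha>, c) \<in> r \<and> (c, \<beta>) \<in> r) \<Longrightarrow> \<beta> \<in> K"
    "\<beta> \<in> K \<Longrightarrow> finite b \<Longrightarrow> b \<subseteq> seg r \<beta> \<Longrightarrow> finite a \<Longrightarrow> a \<subseteq> K \<Longrightarrow> (\<And>\<gamma>. \<gamma> \<in> a \<Longrightarrow> (\<beta>, \<gamma>) \<in> r)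
      \<Longrightarrow> \<exists>z\<in>\<epsilon> (insert \<beta> b) \<inter> U. z \<in> x \<beta> \<and> (\<forall>\<gamma>\<in>a. z \<in> x \<gamma>) \<and> (\<forall>\<alpha>\<in>b. z \<notin> x \<alpha>)"
proof -
  note * = assms[unfolded ladder_def]
  show "swo I r" using * by (elim conjE)
  show "sm n (seg r c)" using * by (elim conjE) blast
  show "K \<subseteq> I" using * by (elim conjE)
  show "\<exists>\<beta>\<in>K. B \<subseteq> seg r \<beta>" if "B \<subseteq> I" "sm n B" using * that by (elim conjE) blast
  show "\<beta> \<in> K" if "\<beta> \<in> I" "seg r \<beta> \<noteq> {}" "\<And>\<alpha>. \<alpha> \<in> seg r \<beta> \<Longrightarrow> \<exists>c\<in>K. (\<alpha>, c) \<in> r \<and> (c, \<beta>) \<in> r"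
    by (rule *[THEN conjunct2, THEN conjunct2, THEN conjunct2, THEN conjunct2, THEN conjunct1, rule_format])
      (rule that, assumption?)+
  show "\<exists>z\<in>\<epsilon> (insert \<beta> b) \<inter> U. z \<in> x \<beta> \<and> (\<forall>\<gamma>\<in>a. z \<in> x \<gamma>) \<and> (\<forall>\<alpha>\<in>b. z \<notin> x \<alpha>)"
    if "\<beta> \<in> K" "finite b" "b \<subseteq> seg r \<beta>" "finite a" "a \<subseteq> K" "\<And>\<gamma>. \<gamma> \<in> a \<Longrightarrow> (\<beta>, \<gamma>) \<in> r"
    by (rule *[THEN conjunct2, THEN conjunct2, THEN conjunct2, THEN conjunct2, THEN conjunct2, rule_format])
      (rule that, assumption?)+
qed

text \<open>The support clause allows such a family to be subtracted from another one without
  leaving the hull.\<close>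

definition good :: "nat \<Rightarrow> 'i set \<Rightarrow> 'a set \<Rightarrow> bool" where
  "good n I U \<longleftrightarrow> (\<exists>\<theta> :: 'i set \<Rightarrow> 'a \<Rightarrow> 'g. coh x U I n \<theta> \<and> \<not> triv x U I n \<theta>
    \<and> (\<forall>F\<in>fsub I n. \<forall>z. \<theta> F z \<noteq> 0 \<longrightarrow> z \<in> hull \<epsilon> I))"

text \<open>In order type omega each \<open>seg r \<beta>\<close> is finite, so the last clause of
  \<open>ladder\<close>, with all earlier indices as \<open>b\<close>, yields a point of
  \<open>x \<beta>\<close> outside every earlier set. A set \<open>x \<alpha>\<close> contains the
  point chosen for \<open>\<beta>\<close> only if \<open>\<beta>\<close> does not come after
  \<open>\<alpha>\<close>, which leaves finitely many.\<close>

lemma good_0: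
  assumes L: "ladder 0 I r K U"
  shows "good 0 I U"
proof -
  note r = ladderD(1)[OF L]
  obtain g :: 'g where g: "g \<noteq> 0" using nonzero by blast
  have "\<exists>z. z \<in> \<epsilon> (insert \<beta> (seg r \<beta>)) \<and> z \<in> U \<and> z \<in> x \<beta> \<and> (\<forall>\<alpha>\<in>seg r \<beta>. z \<notin> x \<alpha>)" if "\<beta> \<in> K" for \<beta>
    using ladderD(6)[OF L that, of "seg r \<beta>" "{}"] ladderD(2)[OF L] by auto
  then obtain f where f: "\<And>\<beta>. \<beta> \<in> K \<Longrightarrow> f \<beta> \<in> \<epsilon> (insert \<beta> (seg r \<beta>))" "\<And>\<beta>. \<beta> \<in> K \<Longrightarrow> f \<beta> \<in> U"
    "\<And>\<beta>. \<beta> \<in> K \<Longrightarrow> f \<beta> \<in> x \<beta>" "\<And>\<beta> \<alpha>. \<beta> \<in> K \<Longrightarrow> (\<alpha>, \<beta>) \<in> r \<Longrightarrow> f \<beta> \<notin> x \<alpha>"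
    by (metis mem_Collect_eq)
  define \<theta> where "\<theta> F z = (if z \<in> f ` K then g else 0)" for F :: "'i set" and z
  have "infinite K"
    using ladderD(3,4)[OF L] swoD(3)[OF r] by (metis mem_Collect_eq sm_0 subsetD)
  moreover have "inj_on f K"
    using f(3,4) swoD(4)[OF r] ladderD(3)[OF L] unfolding inj_on_def by (metis subsetD)
  ultimately have inf: "infinite (f ` K)" using finite_imageD by blast
  have "coh x U I 0 \<theta>"
    unfolding coh_def
  proof
    fix F assume "F \<in> fsub I (Suc 0)"
    then obtain \<alpha> where \<alpha>: "F = {\<alpha>}" "\<alpha> \<in> I" by (auto simp: fsub_def card_Suc_eq)
    have "{z\<in>dom_on x U F. cob \<theta> F z \<noteq> 0} \<subseteq> f ` insert \<alpha> (seg r \<alpha>)"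
    proof
      fix z assume "z \<in> {z\<in>dom_on x U F. cob \<theta> F z \<noteq> 0}"
      then have z: "z \<in> x \<alpha>" "\<theta> {} z \<noteq> 0" by (auto simp: \<alpha> dom_on_def cob_def)
      then obtain \<beta> where \<beta>: "\<beta> \<in> K" "z = f \<beta>" by (auto simp: \<theta>_def split: if_splits)
      then have "(\<alpha>, \<beta>) \<notin> r" using f(4) z(1) by blast
      then have "\<beta> \<in> insert \<alpha> (seg r \<alpha>)" using swoD(4)[OF r] \<alpha>(2) \<beta>(1) ladderD(3)[OF L] by blast
      then show "z \<in> f ` insert \<alpha> (seg r \<alpha>)" using \<beta>(2) by blast
    qed
    moreover have "finite (f ` insert \<alpha> (seg r \<alpha>))" using ladderD(2)[OF L, of \<alpha>] by simp
    ultimately show "finite {z\<in>dom_on x U F. cob \<theta> F z \<noteq> 0}" using finite_subset by blast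
  qed
  moreover have "\<not> triv x U I 0 \<theta>"
  proof
    assume "triv x U I 0 \<theta>"
    then obtain \<psi> :: "'i set \<Rightarrow> 'a \<Rightarrow> 'g" where "finite {z\<in>dom_on x U {}. \<theta> {} z \<noteq> cob \<psi> {} z}"
      unfolding triv_def by (force simp: fsub_def)
    moreover have "f ` K \<subseteq> {z\<in>dom_on x U {}. \<theta> {} z \<noteq> cob \<psi> {} z}"
      using f(2) g by (auto simp: dom_on_def \<theta>_def cob_def)
    ultimately show False using inf finite_subset by blast
  qed
  moreover have "z \<in> hull \<epsilon> I" if "\<theta> F z \<noteq> 0" for F z
  proof -
    obtain \<beta> where \<beta>: "\<beta> \<in> K" "z = f \<beta>" using \<open>\<theta> F z \<noteq> 0\<close> by (auto simp: \<theta>_def split: if_splits)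
    have "finite (insert \<beta> (seg r \<beta>))" "insert \<beta> (seg r \<beta>) \<subseteq> I"
      using ladderD(2)[OF L, of \<beta>] ladderD(3)[OF L] \<beta>(1) swoD(5)[OF r] by auto
    then show ?thesis using f(1)[OF \<beta>(1)] \<beta>(2) unfolding hull_def by blast
  qed
  ultimately show ?thesis unfolding good_def by blast
qed

text \<open>\<open>K\<close> is thinned out to a set \<open>Y\<close> in which each member lies
  above \<open>cl\<close> of all earlier members. \<open>Y\<close> has more than aleph_n elements,
  since otherwise a bound of \<open>Y\<close> and these closures would itself belong to
  \<open>Y\<close>. The stage is the first \<open>\<delta>\<close> with at least aleph_n members of
  \<open>Y\<close> below it: by minimality and regularity, fewer than aleph_n earlier segments
  cannot cover these members, so small sets are bounded below \<open>\<delta>\<close>.\<close>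

lemma choose_stage:
  assumes L: "ladder (Suc n) I r K U" and n: "n \<le> N"
    and cl: "\<And>\<alpha>. sm (Suc n) (cl \<alpha>)" "\<And>\<alpha>. cl \<alpha> \<subseteq> I"
  shows "\<exists>\<delta>\<in>K. (\<forall>B. B \<subseteq> seg r \<delta> \<longrightarrow> sm n B \<longrightarrow> (\<exists>\<beta>\<in>K \<inter> seg r \<delta>. B \<subseteq> seg r \<beta>))
    \<and> (\<forall>B. B \<subseteq> seg r \<delta> \<longrightarrow> finite B \<longrightarrow> (\<exists>\<beta>\<in>seg r \<delta>. B \<subseteq> seg r \<beta> \<and> cl \<beta> \<subseteq> seg r \<delta>))"
proof -
  note r = ladderD(1)[OF L]
  \<comment> \<open>Membership in \<open>Y\<close> is decided by recursion: \<open>f y\<close>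
    refers to \<open>f\<close> only at predecessors of \<open>y\<close>.\<close>
  have "\<exists>f. \<forall>y. f y \<longleftrightarrow> y \<in> K \<and> (\<forall>\<alpha>\<in>seg r y. f \<alpha> \<longrightarrow> cl \<alpha> \<subseteq> seg r y)"
  proof (rule dependent_wf_choice[OF swoD(1)[OF r]])
    fix f g :: "'i \<Rightarrow> bool" and y b
    assume "\<And>\<alpha>. (\<alpha>, y) \<in> r \<Longrightarrow> f \<alpha> = g \<alpha>"
    then show "(b \<longleftrightarrow> y \<in> K \<and> (\<forall>\<alpha>\<in>seg r y. f \<alpha> \<longrightarrow> cl \<alpha> \<subseteq> seg r y))
        = (b \<longleftrightarrow> y \<in> K \<and> (\<forall>\<alpha>\<in>seg r y. g \<alpha> \<longrightarrow> cl \<alpha> \<subseteq> seg r y))"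
      by simp
  qed blast
  then obtain f where f: "\<And>y. f y \<longleftrightarrow> y \<in> K \<and> (\<forall>\<alpha>\<in>seg r y. f \<alpha> \<longrightarrow> cl \<alpha> \<subseteq> seg r y)" by blast
  define Y where "Y = {y. f y}"
  have YK: "Y \<subseteq> K" unfolding Y_def using f by blast
  have large: "\<not> sm (Suc n) Y"
  proof
    assume "sm (Suc n) Y"
    then have "sm (Suc n) (\<Union>\<alpha>\<in>Y. insert \<alpha> (cl \<alpha>))" using n cl by (intro sm_UN sm_insert) auto
    moreover have "(\<Union>\<alpha>\<in>Y. insert \<alpha> (cl \<alpha>)) \<subseteq> I" using cl(2) YK ladderD(3)[OF L] by auto
    ultimately obtain \<beta> where "\<beta> \<in> K" "(\<Union>\<alpha>\<in>Y. insert \<alpha> (cl \<alpha>)) \<subseteq> seg r \<beta>"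
      using ladderD(4)[OF L] by blast
    then have "f \<beta>" "Y \<subseteq> seg r \<beta>" using f[of \<beta>] by (auto simp: Y_def)
    then show False using swoD(3)[OF r] by (auto simp: Y_def)
  qed
  obtain X where X: "X \<subseteq> Y" "sm (Suc n) X" "\<not> sm n X" using subset_exactly[OF n large] by blast
  obtain \<beta> where "\<beta> \<in> K" "X \<subseteq> seg r \<beta>" using ladderD(4)[OF L _ X(2)] X(1) YK ladderD(3)[OF L] by blast
  then have "\<beta> \<in> {\<delta>\<in>I. \<not> sm n (seg r \<delta> \<inter> Y)}"
    using X ladderD(3)[OF L] sm_subset[of n "seg r \<beta> \<inter> Y" X] by blast
  then obtain \<delta> where \<delta>: "\<delta> \<in> I" "\<not> sm n (seg r \<delta> \<inter> Y)"
    and "\<And>\<alpha>. (\<alpha>, \<delta>) \<in> r \<Longrightarrow> \<alpha> \<notin> {\<delta>\<in>I. \<not> sm n (seg r \<delta> \<inter> Y)}"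
    by (rule wfE_min[OF swoD(1)[OF r]]) blast
  then have min: "sm n (seg r \<alpha> \<inter> Y)" if "\<alpha> \<in> seg r \<delta>" for \<alpha>
    using that swoD(5)[OF r] by blast
  have bound: "\<exists>\<beta>\<in>Y \<inter> seg r \<delta>. B \<subseteq> seg r \<beta>" if B: "B \<subseteq> seg r \<delta>" "sm n B" for B
  proof (rule ccontr)
    assume *: "\<not> ?thesis"
    have "seg r \<delta> \<inter> Y \<subseteq> (\<Union>b\<in>B. insert b (seg r b \<inter> Y))"
    proof
      fix y assume y: "y \<in> seg r \<delta> \<inter> Y"
      then obtain b where b: "b \<in> B" "(b, y) \<notin> r" using * by blast
      then have "b = y \<or> (y, b) \<in> r" using swoD(4,5)[OF r] B(1) y by blast
      then show "y \<in> (\<Union>b\<in>B. insert b (seg r b \<inter> Y))" using b(1) y by blast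
    qed
    moreover have "sm n (\<Union>b\<in>B. insert b (seg r b \<inter> Y))"
      using n B min by (intro sm_UN sm_insert) auto
    ultimately show False using \<delta>(2) sm_subset by blast
  qed
  have bound1: "\<exists>\<beta>\<in>Y \<inter> seg r \<delta>. B \<subseteq> seg r \<beta>" if "B \<subseteq> seg r \<delta>" "finite B" for B
    using bound that finite_sm[of n B] n by simp
  show ?thesis
  proof (rule bexI[of _ \<delta>], intro conjI allI impI)
    show "\<exists>\<beta>\<in>K \<inter> seg r \<delta>. B \<subseteq> seg r \<beta>" if "B \<subseteq> seg r \<delta>" "sm n B" for B
      using bound[OF that] YK by blast
    fix B assume "B \<subseteq> seg r \<delta>" "finite B"
    then obtain y where y: "y \<in> Y" "y \<in> seg r \<delta>" "B \<subseteq> seg r y" using bound1 by blast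
    \<comment> \<open>A second member of \<open>Y\<close> is needed, because \<open>cl y\<close> is
      bounded only by the members of \<open>Y\<close> after \<open>y\<close>.\<close>
    obtain y' where y': "y' \<in> Y" "y' \<in> seg r \<delta>" "y \<in> seg r y'" using bound1[of "{y}"] y(2) by blast
    then have "cl y \<subseteq> seg r y'" using f[of y'] y(1) by (auto simp: Y_def)
    also have "\<dots> \<subseteq> seg r \<delta>" using y'(2) swoD(2)[OF r] by blast
    finally show "\<exists>\<beta>\<in>seg r \<delta>. B \<subseteq> seg r \<beta> \<and> cl \<beta> \<subseteq> seg r \<delta>" using y by blast
  next
    show "\<delta> \<in> K"
    proof (rule ladderD(5)[OF L \<delta>(1)])
      show "seg r \<delta> \<noteq> {}" using bound1[of "{}"] by blast
      fix \<alpha> assume "\<alpha> \<in> seg r \<delta>"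
      then show "\<exists>c\<in>K. (\<alpha>, c) \<in> r \<and> (c, \<delta>) \<in> r" using bound1[of "{\<alpha>}"] YK by blast
    qed
  qed
qed

text \<open>The segment below a stage of cofinality \<open>\<omega>\<^sub>n\<close> is re-enumerated in order type \<open>\<omega>\<^sub>n\<close>, in blocks
  consisting of a point \<open>c \<xi>\<close> of \<open>K\<close> above everything enumerated before, followed by \<open>\<xi>\<close>.\<close>
lemma ladder_segment:
  assumes L: "ladder (Suc n) I r K U" and n: "n \<le> N" and \<delta>: "\<delta> \<in> K"
    and bound: "\<forall>B. B \<subseteq> seg r \<delta> \<longrightarrow> sm n B \<longrightarrow> (\<exists>\<beta>\<in>K \<inter> seg r \<delta>. B \<subseteq> seg r \<beta>)"
  shows "\<exists>r' K'. ladder n (seg r \<delta>) r' K' (U \<inter> x \<delta>)"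
proof -
  note r = ladderD(1)[OF L]
  define J where "J = seg r \<delta>"
  obtain s where s: "swo J s" and sm_s: "\<And>a. sm n (seg s a)"
    using sm_order[OF n ladderD(2)[OF L, of \<delta>]] unfolding J_def by blast
  \<comment> \<open>The leading points of the blocks. Before \<open>\<xi>\<close> fewer than aleph_n
    points have been listed, so \<open>bound\<close> supplies a point of \<open>K\<close> above all
    of them.\<close>
  have "\<exists>c. \<forall>\<xi>. \<xi> \<in> J \<longrightarrow> c \<xi> \<in> K \<inter> J \<and> (\<forall>\<eta>\<in>seg s \<xi>. (\<eta>, c \<xi>) \<in> r \<and> (c \<eta>, c \<xi>) \<in> r)"
  proof (rule dependent_wf_choice[OF swoD(1)[OF s]])
    fix \<xi> c
    assume IH: "\<And>\<eta>. (\<eta>, \<xi>) \<in> s \<Longrightarrow> \<eta> \<in> J \<longrightarrow> c \<eta> \<in> K \<inter> J \<and> (\<forall>\<eta>'\<in>seg s \<eta>. (\<eta>', c \<eta>) \<in> r \<and> (c \<eta>', c \<eta>) \<in> r)"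
    have "sm n (seg s \<xi> \<union> c ` seg s \<xi>)"
    proof -
      have "seg s \<xi> \<union> c ` seg s \<xi> = (\<Union>\<eta>\<in>seg s \<xi>. {\<eta>, c \<eta>})" by auto
      moreover have "sm n (\<Union>\<eta>\<in>seg s \<xi>. {\<eta>, c \<eta>})"
        by (rule sm_UN[OF _ sm_s finite_sm]) (use n in simp_all)
      ultimately show ?thesis by simp
    qed
    moreover have "seg s \<xi> \<union> c ` seg s \<xi> \<subseteq> J" using IH swoD(5)[OF s] by blast
    ultimately obtain \<beta> where "\<beta> \<in> K \<inter> J" "seg s \<xi> \<union> c ` seg s \<xi> \<subseteq> seg r \<beta>"
      using bound unfolding J_def by meson
    then show "\<exists>\<beta>. \<xi> \<in> J \<longrightarrow> \<beta> \<in> K \<inter> J \<and> (\<forall>\<eta>\<in>seg s \<xi>. (\<eta>, \<beta>) \<in> r \<and> (c \<eta>, \<beta>) \<in> r)" by blast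
  next
    fix f g :: "'i \<Rightarrow> 'i" and \<xi> \<beta>
    assume "\<And>\<eta>. (\<eta>, \<xi>) \<in> s \<Longrightarrow> f \<eta> = g \<eta>"
    then show "(\<xi> \<in> J \<longrightarrow> \<beta> \<in> K \<inter> J \<and> (\<forall>\<eta>\<in>seg s \<xi>. (\<eta>, \<beta>) \<in> r \<and> (f \<eta>, \<beta>) \<in> r))
        = (\<xi> \<in> J \<longrightarrow> \<beta> \<in> K \<inter> J \<and> (\<forall>\<eta>\<in>seg s \<xi>. (\<eta>, \<beta>) \<in> r \<and> (g \<eta>, \<beta>) \<in> r))"
      by simp
  qed
  then obtain c where c: "\<And>\<xi>. \<xi> \<in> J \<Longrightarrow> c \<xi> \<in> K" "\<And>\<xi>. \<xi> \<in> J \<Longrightarrow> c \<xi> \<in> J"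
    "\<And>\<xi> \<eta>. (\<eta>, \<xi>) \<in> s \<Longrightarrow> (\<eta>, c \<xi>) \<in> r" "\<And>\<xi> \<eta>. (\<eta>, \<xi>) \<in> s \<Longrightarrow> (c \<eta>, c \<xi>) \<in> r"
    using swoD(6)[OF s] by blast
  \<comment> \<open>A point can occur in several blocks; \<open>\<rho> i\<close> will be the first
    block in which \<open>i\<close> occurs, so that repetitions are ignored.\<close>
  have "\<exists>\<xi>. \<xi> \<in> J \<and> i \<in> {c \<xi>, \<xi>} \<and> (\<forall>\<eta>\<in>seg s \<xi>. i \<notin> {c \<eta>, \<eta>})" if "i \<in> J" for i
  proof -
    have "i \<in> {\<xi>\<in>J. i \<in> {c \<xi>, \<xi>}}" using that by auto
    then obtain \<xi> where "\<xi> \<in> {\<xi>\<in>J. i \<in> {c \<xi>, \<xi>}}" "\<And>\<eta>. (\<eta>, \<xi>) \<in> s \<Longrightarrow> \<eta> \<notin> {\<xi>\<in>J. i \<in> {c \<xi>, \<xi>}}"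
      by (rule wfE_min[OF swoD(1)[OF s]]) blast
    then show ?thesis using swoD(5)[OF s] by blast
  qed
  then obtain \<rho> where \<rho>: "\<And>i. i \<in> J \<Longrightarrow> \<rho> i \<in> J" "\<And>i. i \<in> J \<Longrightarrow> i = c (\<rho> i) \<or> i = \<rho> i"
    "\<And>i \<eta>. i \<in> J \<Longrightarrow> (\<eta>, \<rho> i) \<in> s \<Longrightarrow> i \<noteq> c \<eta> \<and> i \<noteq> \<eta>"
    by (metis insertCI insertE mem_Collect_eq singletonD)
  \<comment> \<open>A leading point is new: it is strictly \<open>r\<close>-above everything in the
    earlier blocks.\<close>
  have \<rho>_c: "\<rho> (c \<xi>) = \<xi>" if "\<xi> \<in> J" for \<xi>
  proof (rule ccontr)
    assume ne: "\<rho> (c \<xi>) \<noteq> \<xi>"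
    have J: "c \<xi> \<in> J" "\<rho> (c \<xi>) \<in> J" using c(2) that \<rho>(1) by auto
    have "(\<xi>, \<rho> (c \<xi>)) \<notin> s" using \<rho>(3)[OF J(1)] by blast
    then have "(\<rho> (c \<xi>), \<xi>) \<in> s" using swoD(4)[OF s] that J ne by blast
    then have "(\<rho> (c \<xi>), c \<xi>) \<in> r" "(c (\<rho> (c \<xi>)), c \<xi>) \<in> r" using c(3,4) by auto
    then show False using \<rho>(2)[OF J(1)] swoD(3)[OF r] by metis
  qed
  \<comment> \<open>\<open>q\<close> separates the two places of a block: false for the leading
    point, true for the point after it. If \<open>c \<xi> = \<xi>\<close>, the block has one point
    and \<open>q\<close> is false there.\<close>
  define q where "q i \<longleftrightarrow> i \<noteq> c (\<rho> i)" for i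
  have q: "\<not> q i \<Longrightarrow> i = c (\<rho> i)" "i \<in> J \<Longrightarrow> q i \<Longrightarrow> i = \<rho> i" for i
    using \<rho>(2) unfolding q_def by blast+
  have q_c: "\<not> q (c \<xi>)" if "\<xi> \<in> J" for \<xi>
    unfolding q_def \<rho>_c[OF that] by simp
  define m where "m i = (\<rho> i, q i)" for i
  define l where "l = s <*lex*> {(False, True)}"
  define r' where "r' = {(i, j). i \<in> J \<and> j \<in> J \<and> (m i, m j) \<in> l}"
  define K' where "K' = c ` J"
  have r'_iff: "(i, j) \<in> r' \<longleftrightarrow> i \<in> J \<and> j \<in> J \<and> ((\<rho> i, \<rho> j) \<in> s \<or> \<rho> i = \<rho> j \<and> \<not> q i \<and> q j)"
    for i j by (auto simp: r'_def l_def m_def)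
  have r'_c: "(i, c \<xi>) \<in> r' \<longleftrightarrow> i \<in> J \<and> (\<rho> i, \<xi>) \<in> s" if "\<xi> \<in> J" for i \<xi>
    using that c(2) q_c \<rho>_c by (simp add: r'_iff)
  have r': "swo J r'"
    unfolding swo_def
  proof (intro conjI)
    have "wf {(False, True)}"
      by (rule wf_subset[OF wf_measure[of "\<lambda>b. if b then 1 else 0"]]) auto
    then have "wf l" unfolding l_def using swoD(1)[OF s] by (rule wf_lex_prod[rotated])
    then show "wf r'" by (rule wf_subset[OF wf_inv_image[of _ m]]) (auto simp: r'_def inv_image_def)
    have "trans l" unfolding l_def using s by (intro trans_lex_prod) (auto simp: swo_def trans_def)
    then show "trans r'" unfolding r'_def trans_def by blast
    show "total_on J r'" unfolding total_on_def
    proof (intro ballI impI)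
      fix i j assume ij: "i \<in> J" "j \<in> J" "i \<noteq> j"
      show "(i, j) \<in> r' \<or> (j, i) \<in> r'"
      proof (cases "\<rho> i = \<rho> j")
        case True
        then have "q i \<noteq> q j" using ij q by metis
        then show ?thesis using True ij by (cases "q j") (simp_all add: r'_iff)
      next
        case False
        then have "(\<rho> i, \<rho> j) \<in> s \<or> (\<rho> j, \<rho> i) \<in> s"
          using swoD(4)[OF s \<rho>(1)[OF ij(1)] \<rho>(1)[OF ij(2)]] by blast
        then show ?thesis using ij by (auto simp: r'_iff)
      qed
    qed
  qed (auto simp: r'_def)
  have before: "\<exists>\<eta>\<in>seg s \<xi>. i = c \<eta> \<or> i = \<eta>" if "(i, c \<xi>) \<in> r'" "\<xi> \<in> J" for i \<xi>
  proof -
    have "\<rho> i \<in> seg s \<xi>" "i \<in> J" using that r'_c by auto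
    then show ?thesis using \<rho>(2) by blast
  qed
  have "ladder n J r' K' (U \<inter> x \<delta>)"
    unfolding ladder_def
  proof (intro conjI allI ballI impI)
    show "sm n (seg r' j)" for j
    proof -
      have "seg r' j \<subseteq> (\<Union>\<xi>\<in>insert (\<rho> j) (seg s (\<rho> j)). {c \<xi>, \<xi>})"
      proof
        fix i assume "i \<in> seg r' j"
        then have "i \<in> J" "\<rho> i \<in> insert (\<rho> j) (seg s (\<rho> j))" by (auto simp: r'_iff)
        then show "i \<in> (\<Union>\<xi>\<in>insert (\<rho> j) (seg s (\<rho> j)). {c \<xi>, \<xi>})" using \<rho>(2) by blast
      qed
      moreover have "sm n (\<Union>\<xi>\<in>insert (\<rho> j) (seg s (\<rho> j)). {c \<xi>, \<xi>})"
        by (rule sm_UN[OF _ sm_insert[OF _ sm_s] finite_sm]) (use n in simp_all)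
      ultimately show ?thesis using sm_subset by blast
    qed
    show "K' \<subseteq> J" using c(2) by (auto simp: K'_def)
    show "\<exists>\<beta>\<in>K'. B \<subseteq> seg r' \<beta>" if B: "B \<subseteq> J" "sm n B" for B
    proof -
      have "\<not> J \<subseteq> (\<Union>b\<in>B. insert (\<rho> b) (seg s (\<rho> b)))"
      proof
        assume "J \<subseteq> (\<Union>b\<in>B. insert (\<rho> b) (seg s (\<rho> b)))"
        moreover have "sm n (\<Union>b\<in>B. insert (\<rho> b) (seg s (\<rho> b)))"
          by (rule sm_UN[OF _ B(2) sm_insert[OF _ sm_s]]) (use n in simp_all)
        ultimately have "sm n J" using sm_subset by blast
        then obtain \<beta> where "\<beta> \<in> J" "J \<subseteq> seg r \<beta>" using bound unfolding J_def by blast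
        then show False using swoD(3)[OF r] by blast
      qed
      then obtain \<xi> where \<xi>: "\<xi> \<in> J" "\<And>b. b \<in> B \<Longrightarrow> \<xi> \<noteq> \<rho> b \<and> (\<xi>, \<rho> b) \<notin> s" by blast
      then have "(\<rho> b, \<xi>) \<in> s" if "b \<in> B" for b
        using swoD(4)[OF s, of \<xi> "\<rho> b"] B(1) \<rho>(1) that by blast
      then have "B \<subseteq> seg r' (c \<xi>)" using B(1) r'_c[OF \<xi>(1)] by blast
      then show ?thesis using \<xi>(1) by (auto simp: K'_def)
    qed
    \<comment> \<open>Closedness holds because a point outside \<open>K'\<close> comes directly
      after the leading point of its block, and so is not a limit of \<open>K'\<close>.\<close>
    show "\<beta> \<in> K'"
      if \<beta>: "\<beta> \<in> J" and lim: "\<forall>\<alpha>\<in>seg r' \<beta>. \<exists>c\<in>K'. (\<alpha>, c) \<in> r' \<and> (c, \<beta>) \<in> r'" for \<beta>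
    proof (rule ccontr)
      note \<rho>\<beta> = \<rho>(1)[OF \<beta>]
      assume "\<beta> \<notin> K'"
      then have "q \<beta>" using q(1) \<rho>\<beta> unfolding K'_def by blast
      then have "(c (\<rho> \<beta>), \<beta>) \<in> r'" using \<rho>_c[OF \<rho>\<beta>] c(2)[OF \<rho>\<beta>] q_c[OF \<rho>\<beta>] \<beta> by (simp add: r'_iff)
      then obtain \<xi> where \<xi>: "\<xi> \<in> J" "(c (\<rho> \<beta>), c \<xi>) \<in> r'" "(c \<xi>, \<beta>) \<in> r'"
        using lim unfolding K'_def by blast
      then have "(\<rho> \<beta>, \<xi>) \<in> s" using \<rho>_c[OF \<rho>\<beta>] by (simp add: r'_c)
      moreover have "(\<xi>, \<rho> \<beta>) \<in> s \<or> \<xi> = \<rho> \<beta>" using \<xi>(3) \<rho>_c[OF \<xi>(1)] by (auto simp: r'_iff)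
      ultimately show False using swoD(2,3)[OF s] by blast
    qed
    fix \<beta> b a
    assume \<beta>: "\<beta> \<in> K'" and b: "finite b" "b \<subseteq> seg r' \<beta>" and a: "finite a" "a \<subseteq> K'" "\<forall>\<gamma>\<in>a. (\<beta>, \<gamma>) \<in> r'"
    obtain \<xi> where \<xi>: "\<xi> \<in> J" "\<beta> = c \<xi>" using \<beta> by (auto simp: K'_def)
    \<comment> \<open>The orders \<open>r'\<close> and \<open>r\<close> may disagree in general, but
      \<open>r'\<close>-predecessors of a leading point lie in earlier blocks and hence are
      \<open>r\<close>-below it.\<close>
    have "b \<subseteq> seg r \<beta>" using b(2) before[OF _ \<xi>(1)] c(3,4) \<xi>(2) by blast
    \<comment> \<open>Adding \<open>\<delta>\<close> to \<open>a\<close> puts the point obtained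
      into \<open>x \<delta>\<close>, as the new ambient set demands.\<close>
    moreover have "(\<beta>, \<gamma>) \<in> r" if \<gamma>: "\<gamma> \<in> insert \<delta> a" for \<gamma>
    proof (cases "\<gamma> = \<delta>")
      case True
      then show ?thesis using c(2)[OF \<xi>(1)] \<xi>(2) by (simp add: J_def)
    next
      case False
      then obtain \<eta> where \<eta>: "\<eta> \<in> J" "\<gamma> = c \<eta>" 
        using \<gamma> a(2) unfolding K'_def by blast
      then have "(c \<xi>, c \<eta>) \<in> r'" using a(3) \<gamma> False \<xi>(2) \<eta>(2) by blast
      then have "(\<xi>, \<eta>) \<in> s" using r'_c[OF \<eta>(1)] \<rho>_c[OF \<xi>(1)] by simp
      then show ?thesis using c(4) \<xi>(2) \<eta>(2) by blast
    qed
    moreover have "insert \<delta> a \<subseteq> K" "\<beta> \<in> K" using a(2) c(1) \<delta> \<xi> unfolding K'_def by blast+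
    ultimately obtain z where "z \<in> \<epsilon> (insert \<beta> b) \<inter> U" "z \<in> x \<beta>" "\<forall>\<gamma>\<in>insert \<delta> a. z \<in> x \<gamma>" "\<forall>\<alpha>\<in>b. z \<notin> x \<alpha>"
      using ladderD(6)[OF L, of \<beta> b "insert \<delta> a"] a(1) b(1) by blast
    then show "\<exists>z\<in>\<epsilon> (insert \<beta> b) \<inter> (U \<inter> x \<delta>). z \<in> x \<beta> \<and> (\<forall>\<gamma>\<in>a. z \<in> x \<gamma>) \<and> (\<forall>\<alpha>\<in>b. z \<notin> x \<alpha>)"
      by auto
  qed (rule r')
  then show ?thesis unfolding J_def by blast
qed

end

section \<open>Nontrivial families\<close>

context ladders
begin

text \<open>There are two candidates, \<open>\<Psi>\<close> and
  \<open>\<Psi> - em c \<theta>\<close>. Both trivialize \<open>\<Phi>\<close> because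
  \<open>\<theta>\<close> is coherent, and their projections by \<open>pr c\<close> differ by
  \<open>\<theta>\<close>. If both projections were trivial, so would be
  \<open>\<theta>\<close>.\<close>

lemma diag_extend:
  fixes \<Phi> :: "'i set \<Rightarrow> 'a \<Rightarrow> 'g"
  assumes sm: "sm (Suc n) A" and n: "n \<le> N"
    and coh: "coh x U A (Suc n) \<Phi>"
    and supp: "\<forall>F\<in>fsub A (Suc n). \<forall>z. \<Phi> F z \<noteq> 0 \<longrightarrow> z \<in> hull \<epsilon> A"
  shows "\<exists>\<rho>. (\<forall>F\<in>fsub A (Suc n). finite {z\<in>dom_on x (U \<inter> x c) F. \<Phi> F z \<noteq> cob \<rho> F z})
    \<and> (\<forall>G\<in>fsub A n. \<forall>z. \<rho> G z \<noteq> 0 \<longrightarrow> z \<in> hull \<epsilon> A)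
    \<and> (good n A (U \<inter> x c) \<longrightarrow> \<not> triv x (U \<inter> x c) A n (\<lambda>G z. pr c (\<rho> G z)))"
proof -
  have "triv x U A (Suc n) \<Phi>" using sm_triv[OF n sm _ coh] by simp
  then obtain \<Psi>0 where \<Psi>0: "\<And>F. F \<in> fsub A (Suc n) \<Longrightarrow> finite {z\<in>dom_on x U F. \<Phi> F z \<noteq> cob \<Psi>0 F z}"
    unfolding triv_def by blast
  \<comment> \<open>Cutting a trivialization down to the hull is harmless, since
    \<open>\<Phi>\<close> vanishes off the hull.\<close>
  define \<Psi> where "\<Psi> G z = (if z \<in> hull \<epsilon> A then \<Psi>0 G z else 0)" for G z
  have \<Psi>: "finite {z\<in>dom_on x (U \<inter> x c) F. \<Phi> F z \<noteq> cob \<Psi> F z}" if F: "F \<in> fsub A (Suc n)" for F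
  proof (rule finite_subset[OF _ \<Psi>0[OF F]])
    show "{z\<in>dom_on x (U \<inter> x c) F. \<Phi> F z \<noteq> cob \<Psi> F z} \<subseteq> {z\<in>dom_on x U F. \<Phi> F z \<noteq> cob \<Psi>0 F z}"
      using supp F by (auto simp: \<Psi>_def[abs_def] cob_cut dom_on_def split: if_splits)
  qed
  have \<Psi>_supp: "z \<in> hull \<epsilon> A" if "\<Psi> G z \<noteq> 0" for G z
    using that by (simp add: \<Psi>_def split: if_splits)
  show ?thesis
  proof (cases "good n A (U \<inter> x c) \<and> triv x (U \<inter> x c) A n (\<lambda>G z. pr c (\<Psi> G z))")
    case False
    then show ?thesis using \<Psi> \<Psi>_supp by (intro exI[of _ \<Psi>]) simp
  next
    case True
    then obtain \<theta> :: "'i set \<Rightarrow> 'a \<Rightarrow> 'g" where \<theta>: "coh x (U \<inter> x c) A n \<theta>" "\<not> triv x (U \<inter> x c) A n \<theta>"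
      "\<And>F z. F \<in> fsub A n \<Longrightarrow> \<theta> F z \<noteq> 0 \<Longrightarrow> z \<in> hull \<epsilon> A"
      unfolding good_def by blast
    define \<rho> where "\<rho> G z = \<Psi> G z - em c (\<theta> G z)" for G z
    have em0: "em c 0 = 0" by (rule additive_zero[of "em c", OF em_add])
    show ?thesis
    proof (intro exI[of _ \<rho>] conjI ballI allI impI)
      fix F assume F: "F \<in> fsub A (Suc n)"
      have "cob \<rho> F z = cob \<Psi> F z - em c (cob \<theta> F z)" for z
        by (simp add: \<rho>_def[abs_def] cob_diff cob_additive[of "em c", OF em_add])
      then have "{z\<in>dom_on x (U \<inter> x c) F. \<Phi> F z \<noteq> cob \<rho> F z} \<subseteq>
          {z\<in>dom_on x (U \<inter> x c) F. \<Phi> F z \<noteq> cob \<Psi> F z} \<union> {z\<in>dom_on x (U \<inter> x c) F. cob \<theta> F z \<noteq> 0}"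
        using em0 by auto
      then show "finite {z\<in>dom_on x (U \<inter> x c) F. \<Phi> F z \<noteq> cob \<rho> F z}"
        using \<Psi>[OF F] \<theta>(1) F unfolding coh_def by (meson finite_UnI finite_subset)
    next
      fix G z assume "G \<in> fsub A n" "\<rho> G z \<noteq> 0"
      then have "\<Psi> G z \<noteq> 0 \<or> \<theta> G z \<noteq> 0" using em0 by (auto simp: \<rho>_def)
      then show "z \<in> hull \<epsilon> A" using \<theta>(3) \<Psi>_supp \<open>G \<in> fsub A n\<close> by blast
    next
      obtain \<tau> :: "'i set \<Rightarrow> 'a \<Rightarrow> 'g" where
        \<tau>: "\<And>G. G \<in> fsub A n \<Longrightarrow> finite {z\<in>dom_on x (U \<inter> x c) G. pr c (\<Psi> G z) \<noteq> cob \<tau> G z}"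
        using True unfolding triv_def by blast
      show "\<not> triv x (U \<inter> x c) A n (\<lambda>G z. pr c (\<rho> G z))"
      proof
        assume "triv x (U \<inter> x c) A n (\<lambda>G z. pr c (\<rho> G z))"
        then obtain \<sigma> :: "'i set \<Rightarrow> 'a \<Rightarrow> 'g" where
          \<sigma>: "\<And>G. G \<in> fsub A n \<Longrightarrow> finite {z\<in>dom_on x (U \<inter> x c) G. pr c (\<rho> G z) \<noteq> cob \<sigma> G z}"
          unfolding triv_def by blast
        have \<theta>_eq: "\<theta> G z = pr c (\<Psi> G z) - pr c (\<rho> G z)" for G z
        proof -
          have "pr c (\<rho> G z) = pr c (\<Psi> G z) - pr c (em c (\<theta> G z))"
            unfolding \<rho>_def by (rule additive_diff) (rule pr_add)
          then show ?thesis by (simp add: pr_em)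
        qed
        have "{z\<in>dom_on x (U \<inter> x c) G. \<theta> G z \<noteq> cob (\<lambda>G z. \<tau> G z - \<sigma> G z) G z}
            \<subseteq> {z\<in>dom_on x (U \<inter> x c) G. pr c (\<Psi> G z) \<noteq> cob \<tau> G z}
              \<union> {z\<in>dom_on x (U \<inter> x c) G. pr c (\<rho> G z) \<noteq> cob \<sigma> G z}" for G
          by (auto simp: cob_diff \<theta>_eq)
        then have "finite {z\<in>dom_on x (U \<inter> x c) G. \<theta> G z \<noteq> cob (\<lambda>G z. \<tau> G z - \<sigma> G z) G z}"
          if "G \<in> fsub A n" for G
          using \<tau>[OF that] \<sigma>[OF that] by (meson finite_UnI finite_subset)
        then show False using \<theta>(2) unfolding triv_def by blast
      qed
    qed
  qed
qed

text \<open>The new values at stage \<open>c\<close> are chosen with cone \<open>\<rho>\<close> from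
  \<open>diag_extend\<close>. By \<open>cob_insert\<close>, coherence at sets with top
  \<open>c\<close> then says precisely that \<open>\<rho>\<close> trivializes the family built
  before \<open>c\<close>.\<close>

lemma diag_family:
  assumes r: "swo I r" and sm: "\<And>c. sm (Suc n) (seg r c)" and n: "n \<le> N"
  shows "\<exists>\<Phi> :: 'i set \<Rightarrow> 'a \<Rightarrow> 'g. coh x U I (Suc n) \<Phi>
    \<and> (\<forall>c\<in>I. \<forall>G\<in>fsub (seg r c) n. \<forall>z. \<Phi> (insert c G) z \<noteq> 0 \<longrightarrow> z \<in> hull \<epsilon> (seg r c))
    \<and> (\<forall>c\<in>I. good n (seg r c) (U \<inter> x c) \<longrightarrow>
      \<not> triv x (U \<inter> x c) (seg r c) n (\<lambda>G z. pr c (cone \<Phi> c G z)))"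
proof -
  define R where "R c \<Phi> \<longleftrightarrow>
      (\<forall>F\<in>fsub (seg r c) (Suc n). finite {z\<in>dom_on x U (insert c F). cob \<Phi> (insert c F) z \<noteq> 0})
    \<and> (\<forall>G\<in>fsub (seg r c) n. \<forall>z. \<Phi> (insert c G) z \<noteq> 0 \<longrightarrow> z \<in> hull \<epsilon> (seg r c))
    \<and> (good n (seg r c) (U \<inter> x c) \<longrightarrow>
        \<not> triv x (U \<inter> x c) (seg r c) n (\<lambda>G z. pr c (cone \<Phi> c G z)))"
    for c and \<Phi> :: "'i set \<Rightarrow> 'a \<Rightarrow> 'g"
  have "\<exists>\<Phi>. \<forall>c\<in>I. R c \<Phi>"
  proof (rule family_recursion[OF r])
    fix c and \<Phi> \<Phi>' :: "'i set \<Rightarrow> 'a \<Rightarrow> 'g"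
    assume c: "c \<in> I" and eq: "\<And>F. finite F \<Longrightarrow> F \<noteq> {} \<Longrightarrow> F \<subseteq> insert c (seg r c) \<Longrightarrow> \<Phi> F = \<Phi>' F"
      and R: "R c \<Phi>"
    have eq1: "\<Phi>' (insert c G) = \<Phi> (insert c G)" if "G \<in> fsub (seg r c) j" for G j
    proof -
      have "insert c G \<subseteq> insert c (seg r c)" "finite (insert c G)" using that by (auto simp: fsub_def)
      then show ?thesis using eq[of "insert c G"] by simp
    qed
    have "cob \<Phi> (insert c F) z = cob \<Phi>' (insert c F) z" if F: "F \<in> fsub (seg r c) (Suc n)" for F z
    proof (rule cob_cong)
      fix i assume i: "i \<in> insert c F"
      note F' = fsub_seg[OF r c F]
      have "card (insert c F - {i}) = Suc n" using F'(1) i by (auto simp: fsub_def)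
      then have "insert c F - {i} \<noteq> {}" by (metis card.empty nat.distinct(1))
      moreover have "insert c F - {i} \<subseteq> insert c (seg r c)" using F by (auto simp: fsub_def)
      ultimately show "\<Phi> (insert c F - {i}) z = \<Phi>' (insert c F - {i}) z"
        using eq[of "insert c F - {i}"] F'(3) by simp
    qed
    moreover have "triv x (U \<inter> x c) (seg r c) n (\<lambda>G z. pr c (cone \<Phi> c G z))
        \<longleftrightarrow> triv x (U \<inter> x c) (seg r c) n (\<lambda>G z. pr c (cone \<Phi>' c G z))"
      by (rule triv_cong) (simp add: cone_def eq1)
    ultimately show "R c \<Phi>'" using R eq1 unfolding R_def by simp
  next
    fix c and \<Phi> :: "'i set \<Rightarrow> 'a \<Rightarrow> 'g"
    assume c: "c \<in> I" and R: "\<And>a. a \<in> seg r c \<Longrightarrow> R a \<Phi>"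
    have top: "\<exists>a G. a \<in> seg r c \<and> F = insert a G \<and> G \<in> fsub (seg r a) j"
      if F: "F \<in> fsub (seg r c) (Suc j)" for F j
    proof -
      have "F \<in> fsub I (Suc j)" using F swoD(5)[OF r] by (auto simp: fsub_def)
      then obtain a G where "a \<in> I" "F = insert a G" "a \<notin> G" "G \<in> fsub (seg r a) j"
        by (rule fsub_top[OF r])
      then show ?thesis using F by (auto simp: fsub_def)
    qed
    have coh: "coh x U (seg r c) (Suc n) \<Phi>" unfolding coh_def
    proof
      fix F assume "F \<in> fsub (seg r c) (Suc (Suc n))"
      then obtain a G where "a \<in> seg r c" "F = insert a G" "G \<in> fsub (seg r a) (Suc n)"
        using top by blast
      then show "finite {z\<in>dom_on x U F. cob \<Phi> F z \<noteq> 0}" using R[of a] unfolding R_def by blast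
    qed
    have "z \<in> hull \<epsilon> (seg r c)" if F: "F \<in> fsub (seg r c) (Suc n)" "\<Phi> F z \<noteq> 0" for F z
    proof -
      obtain a G where a: "a \<in> seg r c" "F = insert a G" "G \<in> fsub (seg r a) n" using top F(1) by blast
      then have "z \<in> hull \<epsilon> (seg r a)" using R[of a] F(2) unfolding R_def by blast
      moreover have "seg r a \<subseteq> seg r c" using swoD(2)[OF r] a(1) by blast
      ultimately show ?thesis using hull_mono[of "seg r a" "seg r c" \<epsilon>] by (simp add: subset_iff)
    qed
    then have supp: "\<forall>F\<in>fsub (seg r c) (Suc n). \<forall>z. \<Phi> F z \<noteq> 0 \<longrightarrow> z \<in> hull \<epsilon> (seg r c)"
      by blast
    from diag_extend[OF sm n coh supp, where c = c]
    obtain \<rho> where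
      "\<forall>F\<in>fsub (seg r c) (Suc n). finite {z\<in>dom_on x (U \<inter> x c) F. \<Phi> F z \<noteq> cob \<rho> F z}"
      "\<forall>G\<in>fsub (seg r c) n. \<forall>z. \<rho> G z \<noteq> 0 \<longrightarrow> z \<in> hull \<epsilon> (seg r c)"
      "good n (seg r c) (U \<inter> x c) \<longrightarrow> \<not> triv x (U \<inter> x c) (seg r c) n (\<lambda>G z. pr c (\<rho> G z))"
      by blast
    note \<rho> = this[rule_format]
    define \<Phi>' where "\<Phi>' F z = (if c \<in> F then sgm (below c (F - {c})) (\<rho> (F - {c}) z) else \<Phi> F z)" for F z
    have cn: "c \<notin> seg r c" using swoD(3)[OF r] by simp
    have cone: "cone \<Phi>' c G z = \<rho> G z" if "c \<notin> G" for G z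
      using that by (simp add: cone_def \<Phi>'_def)
    have "R c \<Phi>'"
      unfolding R_def
    proof (intro conjI ballI allI impI)
      fix F assume F: "F \<in> fsub (seg r c) (Suc n)"
      note F' = fsub_seg[OF r c F]
      have "cob (cone \<Phi>' c) F z = cob \<rho> F z" for z
        by (rule cob_cong) (use F'(2) in \<open>simp add: cone\<close>)
      then have "cob \<Phi>' (insert c F) z = sgm (below c F) (\<Phi> F z - cob \<rho> F z)" for z
        using F'(2) by (simp add: cob_insert[OF F'(3,2)] \<Phi>'_def)
      then show "finite {z\<in>dom_on x U (insert c F). cob \<Phi>' (insert c F) z \<noteq> 0}"
        using \<rho>(1)[OF F] by (simp add: dom_on_insert)
    next
      fix G z assume "G \<in> fsub (seg r c) n" "\<Phi>' (insert c G) z \<noteq> 0"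
      then show "z \<in> hull \<epsilon> (seg r c)"
        using \<rho>(2)[of G z] fsub_seg(2)[OF r c, of G n] by (simp add: \<Phi>'_def)
    next
      assume "good n (seg r c) (U \<inter> x c)"
      moreover have "triv x (U \<inter> x c) (seg r c) n (\<lambda>G z. pr c (cone \<Phi>' c G z))
          \<longleftrightarrow> triv x (U \<inter> x c) (seg r c) n (\<lambda>G z. pr c (\<rho> G z))"
        by (rule triv_cong) (use fsub_seg(2)[OF r c] in \<open>simp add: cone\<close>)
      ultimately show "\<not> triv x (U \<inter> x c) (seg r c) n (\<lambda>G z. pr c (cone \<Phi>' c G z))"
        using \<rho>(3) by simp
    qed
    moreover have "\<Phi>' F = \<Phi> F" if "F \<subseteq> seg r c" for F
    proof -
      have "c \<notin> F" using that cn by blast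
      then show ?thesis by (intro ext) (simp add: \<Phi>'_def)
    qed
    ultimately show "\<exists>\<Phi>'. (\<forall>F. finite F \<longrightarrow> F \<noteq> {} \<longrightarrow> F \<subseteq> seg r c \<longrightarrow> \<Phi>' F = \<Phi> F) \<and> R c \<Phi>'"
      by (intro exI[of _ \<Phi>']) simp
  qed
  then obtain \<Phi> where \<Phi>: "\<And>c. c \<in> I \<Longrightarrow> R c \<Phi>" by blast
  have "coh x U I (Suc n) \<Phi>" unfolding coh_def
  proof
    fix F assume "F \<in> fsub I (Suc (Suc n))"
    then obtain c G where "c \<in> I" "F = insert c G" "G \<in> fsub (seg r c) (Suc n)"
      by (rule fsub_top[OF r])
    then show "finite {z\<in>dom_on x U F. cob \<Phi> F z \<noteq> 0}" using \<Phi>[of c] unfolding R_def by blast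
  qed
  then show ?thesis using \<Phi> unfolding R_def by (intro exI[of _ \<Phi>]) simp
qed

section \<open>Defeating a trivialization at a single stage\<close>

lemma sm_hull:
  assumes "n \<le> N" "sm (Suc n) A" shows "sm (Suc n) (hull \<epsilon> A)"
  unfolding hull_def
proof (rule sm_UN[OF _ sm_Fpow[OF assms]])
  fix b assume "b \<in> {b. finite b \<and> b \<subseteq> A}"
  then have "countable (\<epsilon> b)" by (simp add: countable_\<epsilon>)
  then show "sm (Suc n) (\<epsilon> b)" by (rule countable_sm[OF assms(1)])
qed (use assms in simp)

text \<open>The support is bounded stage by stage, which is finer than in \<open>good\<close>: the
  final result needs a bound below the largest index of each set.\<close>

lemma ladder_Suc:
  assumes L: "ladder (Suc n) I r K U" and n: "n \<le> N"
    and IH: "\<forall>I r K U. ladder n I r K U \<longrightarrow> good n I U"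
  shows "\<exists>\<Phi> :: 'i set \<Rightarrow> 'a \<Rightarrow> 'g. coh x U I (Suc n) \<Phi> \<and> \<not> triv x U I (Suc n) \<Phi>
    \<and> (\<forall>c\<in>I. \<forall>G\<in>fsub (seg r c) n. \<forall>z. \<Phi> (insert c G) z \<noteq> 0 \<longrightarrow> z \<in> hull \<epsilon> (seg r c))"
proof -
  note r = ladderD(1)[OF L]
  from diag_family[OF r ladderD(2)[OF L] n, of U]
  obtain \<Phi> :: "'i set \<Rightarrow> 'a \<Rightarrow> 'g" where *: "coh x U I (Suc n) \<Phi>
    \<and> (\<forall>c\<in>I. \<forall>G\<in>fsub (seg r c) n. \<forall>z. \<Phi> (insert c G) z \<noteq> 0 \<longrightarrow> z \<in> hull \<epsilon> (seg r c))
    \<and> (\<forall>c\<in>I. good n (seg r c) (U \<inter> x c) \<longrightarrow>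
      \<not> triv x (U \<inter> x c) (seg r c) n (\<lambda>G z. pr c (cone \<Phi> c G z)))" ..
  note \<Phi> = *[THEN conjunct1] *[THEN conjunct2, THEN conjunct1, rule_format]
    *[THEN conjunct2, THEN conjunct2, rule_format]
  have "\<not> triv x U I (Suc n) \<Phi>"
  proof
    assume "triv x U I (Suc n) \<Phi>"
    then obtain T where "\<forall>F\<in>fsub I (Suc n). finite {z\<in>dom_on x U F. \<Phi> F z \<noteq> cob T F z}"
      unfolding triv_def ..
    note T = this[rule_format]
    \<comment> \<open>The coordinates that \<open>T\<close> uses below \<open>\<beta>\<close>. There
      are at most aleph_n pairs of \<open>G\<close> and \<open>z\<close>, and each contributes
      finitely many coordinates.\<close>
    define cl where "cl \<beta> = (\<Union>G\<in>fsub (seg r \<beta>) n. \<Union>z\<in>hull \<epsilon> (seg r \<beta>). {d\<in>I. pr d (T G z) \<noteq> 0})" for \<beta>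
    have "finite {d\<in>I. pr d g \<noteq> 0}" for g :: 'g
      by (rule finite_subset[OF _ finite_pr[of g]]) auto
    then have sm_pr: "sm (Suc n) {d\<in>I. pr d g \<noteq> 0}" for g :: 'g
      by (rule finite_sm[rotated]) (use n in simp)
    have "sm (Suc n) (cl \<beta>)" for \<beta>
      unfolding cl_def
    proof (rule sm_UN[OF _ sm_fsub[OF n]])
      fix G
      show "sm (Suc n) (\<Union>z\<in>hull \<epsilon> (seg r \<beta>). {d\<in>I. pr d (T G z) \<noteq> 0})"
        by (rule sm_UN[OF _ sm_hull[OF n]]) (use n ladderD(2)[OF L] sm_pr in simp_all)
    qed (use n ladderD(2)[OF L] in simp_all)
    moreover have "cl \<beta> \<subseteq> I" for \<beta> by (auto simp: cl_def)
    ultimately have "\<exists>\<delta>\<in>K. (\<forall>B. B \<subseteq> seg r \<delta> \<longrightarrow> sm n B \<longrightarrow> (\<exists>\<beta>\<in>K \<inter> seg r \<delta>. B \<subseteq> seg r \<beta>))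
        \<and> (\<forall>B. B \<subseteq> seg r \<delta> \<longrightarrow> finite B \<longrightarrow> (\<exists>\<beta>\<in>seg r \<delta>. B \<subseteq> seg r \<beta> \<and> cl \<beta> \<subseteq> seg r \<delta>))"
      by (rule choose_stage[OF L n])
    then obtain \<delta> where "\<delta> \<in> K"
      and *: "(\<forall>B. B \<subseteq> seg r \<delta> \<longrightarrow> sm n B \<longrightarrow> (\<exists>\<beta>\<in>K \<inter> seg r \<delta>. B \<subseteq> seg r \<beta>))
        \<and> (\<forall>B. B \<subseteq> seg r \<delta> \<longrightarrow> finite B \<longrightarrow> (\<exists>\<beta>\<in>seg r \<delta>. B \<subseteq> seg r \<beta> \<and> cl \<beta> \<subseteq> seg r \<delta>))" ..
    note \<delta> = \<open>\<delta> \<in> K\<close> *[THEN conjunct1] *[THEN conjunct2, rule_format]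
    have \<delta>I: "\<delta> \<in> I" using \<delta>(1) ladderD(3)[OF L] by blast
    have "good n (seg r \<delta>) (U \<inter> x \<delta>)"
    proof -
      obtain r' K' where "ladder n (seg r \<delta>) r' K' (U \<inter> x \<delta>)"
        using ladder_segment[OF L n \<delta>(1,2)] by blast
      then show ?thesis using IH by blast
    qed
    then have nontriv: "\<not> triv x (U \<inter> x \<delta>) (seg r \<delta>) n (\<lambda>G z. pr \<delta> (cone \<Phi> \<delta> G z))"
      using \<Phi>(3)[OF \<delta>I] by blast
    \<comment> \<open>Both \<open>G\<close> and the finite set witnessing that \<open>z\<close> is
      in the hull lie below some \<open>\<beta>\<close> with \<open>cl \<beta>\<close> below
      \<open>\<delta>\<close>; coordinate \<open>\<delta>\<close> cannot be in
      \<open>cl \<beta>\<close>, as \<open>\<delta>\<close> is not below itself.\<close>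
    have pr0: "pr \<delta> (T G z) = 0" if G: "G \<in> fsub (seg r \<delta>) n" and z: "z \<in> hull \<epsilon> (seg r \<delta>)" for G z
    proof (rule ccontr)
      assume *: "pr \<delta> (T G z) \<noteq> 0"
      obtain b where b: "finite b" "b \<subseteq> seg r \<delta>" "z \<in> \<epsilon> b" using z by (auto simp: hull_def)
      have "finite (G \<union> b)" "G \<union> b \<subseteq> seg r \<delta>" using b G by (auto simp: fsub_def)
      then obtain \<beta> where \<beta>: "G \<union> b \<subseteq> seg r \<beta>" "cl \<beta> \<subseteq> seg r \<delta>" using \<delta>(3) by blast
      then have "G \<in> fsub (seg r \<beta>) n" "z \<in> hull \<epsilon> (seg r \<beta>)"
        using b G by (auto simp: fsub_def hull_def)
      then have "\<delta> \<in> cl \<beta>" using * \<delta>I by (auto simp: cl_def)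
      then show False using \<beta>(2) swoD(3)[OF r] by blast
    qed
    \<comment> \<open>Where \<open>T\<close> is correct, \<open>cob_insert\<close> gives
      \<open>cone \<Phi> \<delta> G = T G - cob (cone T \<delta>) G\<close>, and on the hull
      \<open>pr \<delta>\<close> kills \<open>T G\<close>. Off the hull
      \<open>cone \<Phi> \<delta>\<close> vanishes, so \<open>\<tau>\<close> is set to 0
      there.\<close>
    define \<tau> where "\<tau> H z = (if z \<in> hull \<epsilon> (seg r \<delta>) then - pr \<delta> (cone T \<delta> H z) else 0)" for H z
    have "finite {z\<in>dom_on x (U \<inter> x \<delta>) G. pr \<delta> (cone \<Phi> \<delta> G z) \<noteq> cob \<tau> G z}"
      if G: "G \<in> fsub (seg r \<delta>) n" for G
    proof (rule finite_subset)
      note G' = fsub_seg[OF r \<delta>I G]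
      have pr_0: "pr \<delta> 0 = 0" by (rule additive_zero[of "pr \<delta>", OF pr_add])
      have "pr \<delta> (cone \<Phi> \<delta> G z) = cob \<tau> G z" if eq: "\<Phi> (insert \<delta> G) z = cob T (insert \<delta> G) z" for z
      proof (cases "z \<in> hull \<epsilon> (seg r \<delta>)")
        case True
        have "cone \<Phi> \<delta> G z = T G z - cob (cone T \<delta>) G z"
          by (simp add: cone_def[of \<Phi>] eq cob_insert[OF G'(3,2)])
        then have "pr \<delta> (cone \<Phi> \<delta> G z) = - pr \<delta> (cob (cone T \<delta>) G z)"
          using pr0[OF G True] by (simp add: additive_diff[of "pr \<delta>", OF pr_add])
        moreover have "cob (\<lambda>H z. - pr \<delta> (cone T \<delta> H z)) G z = - pr \<delta> (cob (cone T \<delta>) G z)"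
          by (rule cob_additive) (simp add: pr_add)
        ultimately show ?thesis using True by (simp add: \<tau>_def[abs_def] cob_cut)
      next
        case False
        then have "\<Phi> (insert \<delta> G) z = 0" using \<Phi>(2)[OF \<delta>I G] by blast
        then show ?thesis using False pr_0 by (simp add: \<tau>_def[abs_def] cob_cut cone_def)
      qed
      then show "{z\<in>dom_on x (U \<inter> x \<delta>) G. pr \<delta> (cone \<Phi> \<delta> G z) \<noteq> cob \<tau> G z}
          \<subseteq> {z\<in>dom_on x U (insert \<delta> G). \<Phi> (insert \<delta> G) z \<noteq> cob T (insert \<delta> G) z}"
        by (auto simp: dom_on_insert)
      show "finite {z\<in>dom_on x U (insert \<delta> G). \<Phi> (insert \<delta> G) z \<noteq> cob T (insert \<delta> G) z}"
        by (rule T[OF G'(1)])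
    qed
    then show False using nontriv unfolding triv_def by blast
  qed
  then show ?thesis using \<Phi>(1,2) by (intro exI[of _ \<Phi>]) simp
qed

lemma ladder_good: "n \<le> Suc N \<Longrightarrow> ladder n I r K U \<Longrightarrow> good n I U"
proof (induction n arbitrary: I r K U)
  case 0
  show ?case by (rule good_0[OF 0(2)])
next
  case (Suc n)
  note r = ladderD(1)[OF Suc.prems(2)]
  have IH: "\<forall>I r K U. ladder n I r K U \<longrightarrow> good n I U"
    using Suc.IH Suc.prems(1) by simp
  have "n \<le> N" using Suc.prems(1) by simp
  from ladder_Suc[OF Suc.prems(2) this IH]
  obtain \<Phi> :: "'i set \<Rightarrow> 'a \<Rightarrow> 'g" where "coh x U I (Suc n) \<Phi>" "\<not> triv x U I (Suc n) \<Phi>"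
    "\<forall>c\<in>I. \<forall>G\<in>fsub (seg r c) n. \<forall>z. \<Phi> (insert c G) z \<noteq> 0 \<longrightarrow> z \<in> hull \<epsilon> (seg r c)"
    by blast
  note \<Phi> = this[rule_format]
  have "z \<in> hull \<epsilon> I" if F: "F \<in> fsub I (Suc n)" "\<Phi> F z \<noteq> 0" for F z
  proof -
    obtain c G where c: "c \<in> I" "F = insert c G" "G \<in> fsub (seg r c) n"
      by (rule fsub_top[OF r F(1)])
    have "seg r c \<subseteq> I" using swoD(5)[OF r] by blast
    moreover have "z \<in> hull \<epsilon> (seg r c)" using \<Phi>(3)[OF c(1,3)] F(2) c(2) by simp
    ultimately show ?thesis using hull_mono[of "seg r c" I \<epsilon>] by (simp add: subset_iff)
  qed
  then show ?case using \<Phi>(1,2) unfolding good_def by (intro exI[of _ \<Phi>]) simp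
qed

end

section \<open>Families indexed by sequences\<close>

definition pairs :: "nat \<Rightarrow> (nat \<times> nat) set" where
  "pairs n = {(i, j). i < j \<and> j < n}"

definition inversions :: "'i::linorder list \<Rightarrow> (nat \<times> nat) set" where
  "inversions u = {(i, j) \<in> pairs (length u). u ! j < u ! i}"

lemma finite_pairs [simp]: "finite (pairs n)"
  by (rule finite_subset[of _ "{..<n} \<times> {..<n}"]) (auto simp: pairs_def)

lemma finite_inversions [simp]: "finite (inversions u)"
  by (rule finite_subset[OF _ finite_pairs[of "length u"]]) (auto simp: inversions_def)

lemma prod_neg_one:
  assumes "finite P"
  shows "(\<Prod>(i, j)\<in>P. if Q i j then - 1 else (1::int)) = (- 1) ^ card {(i, j)\<in>P. Q i j}"
proof -
  have "(\<Prod>p\<in>P. if case_prod Q p then - 1 else (1::int)) = (- 1) ^ card {p\<in>P. case_prod Q p}"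
    using assms by (simp add: prod.If_cases Int_def)
  moreover have "{p\<in>P. case_prod Q p} = {(i, j)\<in>P. Q i j}" by auto
  moreover have "(\<Prod>(i, j)\<in>P. if Q i j then - 1 else (1::int)) = (\<Prod>p\<in>P. if case_prod Q p then - 1 else 1)"
    by (rule prod.cong) auto
  ultimately show ?thesis by simp
qed

text \<open>A permutation permutes the two-element sets of positions; putting an image pair back
  into increasing order costs a sign exactly at the inversions of \<open>\<sigma>\<close>.\<close>

lemma prod_pairs_permute:
  fixes g :: "nat \<Rightarrow> nat \<Rightarrow> int"
  assumes \<sigma>: "\<sigma> permutes {..<n}"
    and anti: "\<And>i j. i < n \<Longrightarrow> j < n \<Longrightarrow> i \<noteq> j \<Longrightarrow> g j i = - g i j"
  shows "(\<Prod>(i, j)\<in>pairs n. g (\<sigma> i) (\<sigma> j))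
    = (\<Prod>(i, j)\<in>pairs n. if \<sigma> j < \<sigma> i then - 1 else 1) * (\<Prod>(i, j)\<in>pairs n. g i j)"
proof -
  define \<pi> where "\<pi> = (\<lambda>(i, j). (min (\<sigma> i) (\<sigma> j), max (\<sigma> i) (\<sigma> j)))"
  have lt: "\<sigma> i < n" if "i < n" for i using permutes_in_image[OF \<sigma>, of i] that by simp
  have ne: "\<sigma> i \<noteq> \<sigma> j" if "i \<noteq> j" for i j using permutes_inj[OF \<sigma>] that by (simp add: inj_eq)
  have "inj_on \<pi> (pairs n)"
  proof (rule inj_onI, clarify)
    fix i j k l assume p: "(i, j) \<in> pairs n" "(k, l) \<in> pairs n" "\<pi> (i, j) = \<pi> (k, l)"
    then have "{\<sigma> i, \<sigma> j} = {\<sigma> k, \<sigma> l}" by (auto simp: \<pi>_def min_def max_def split: if_splits)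
    then have "\<sigma> ` {i, j} = \<sigma> ` {k, l}" by simp
    then have "{i, j} = {k, l}" using permutes_inj[OF \<sigma>] by (simp only: inj_image_eq_iff)
    then show "i = k \<and> j = l" using p(1,2) by (auto simp: pairs_def doubleton_eq_iff)
  qed
  moreover have "\<pi> ` pairs n \<subseteq> pairs n"
  proof clarify
    fix i j k l assume "(i, j) \<in> pairs n" "(k, l) = \<pi> (i, j)"
    moreover from this have "\<sigma> i < n" "\<sigma> j < n" "\<sigma> i \<noteq> \<sigma> j" using lt ne by (auto simp: pairs_def)
    ultimately show "(k, l) \<in> pairs n" by (simp add: \<pi>_def pairs_def)
  qed
  ultimately have bij: "bij_betw \<pi> (pairs n) (pairs n)"
    unfolding bij_betw_def using endo_inj_surj[OF finite_pairs] by blast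
  have "(\<Prod>(i, j)\<in>pairs n. g (\<sigma> i) (\<sigma> j))
      = (\<Prod>p\<in>pairs n. (case p of (i, j) \<Rightarrow> if \<sigma> j < \<sigma> i then - 1 else 1) * (case \<pi> p of (i, j) \<Rightarrow> g i j))"
  proof (rule prod.cong[OF refl], clarify)
    fix i j assume "(i, j) \<in> pairs n"
    then have "\<sigma> i < n" "\<sigma> j < n" "\<sigma> i \<noteq> \<sigma> j" using lt ne by (auto simp: pairs_def)
    then show "g (\<sigma> i) (\<sigma> j) = (if \<sigma> j < \<sigma> i then - 1 else 1) * (case \<pi> (i, j) of (i, j) \<Rightarrow> g i j)"
      using anti[of "\<sigma> j" "\<sigma> i"] by (auto simp: \<pi>_def min_def max_def)
  qed
  also have "\<dots> = (\<Prod>(i, j)\<in>pairs n. if \<sigma> j < \<sigma> i then - 1 else 1) * (\<Prod>p\<in>pairs n. case \<pi> p of (i, j) \<Rightarrow> g i j)"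
    by (rule prod.distrib)
  also have "(\<Prod>p\<in>pairs n. case \<pi> p of (i, j) \<Rightarrow> g i j) = (\<Prod>(i, j)\<in>pairs n. g i j)"
    by (rule prod.reindex_bij_betw[OF bij])
  finally show ?thesis .
qed

text \<open>The inverted pairs are \<open>(a, b)\<close> and, for each \<open>m\<close> strictly
  between, \<open>(a, m)\<close> and \<open>(m, b)\<close>.\<close>

lemma card_transpose_inversions:
  assumes "a < b" "b < n"
  shows "odd (card {(i, j)\<in>pairs n. transpose a b j < transpose a b i})"
proof -
  define M where "M = {a<..<b}"
  have "{(i, j)\<in>pairs n. transpose a b j < transpose a b i} = insert (a, b) (Pair a ` M \<union> (\<lambda>m. (m, b)) ` M)"
    using assms by (auto simp: pairs_def M_def transpose_def split: if_splits)
  moreover have "card (Pair a ` M \<union> (\<lambda>m. (m, b)) ` M) = card (Pair a ` M) + card ((\<lambda>m. (m, b)) ` M)"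
    by (rule card_Un_disjoint) (auto simp: M_def)
  moreover have "card (Pair a ` M) = card M" "card ((\<lambda>m. (m, b)) ` M) = card M"
    by (auto intro!: card_image simp: inj_on_def)
  moreover have "(a, b) \<notin> Pair a ` M \<union> (\<lambda>m. (m, b)) ` M" by (auto simp: M_def)
  ultimately show ?thesis by (simp add: M_def)
qed

text \<open>The parity of the inversions is the product of the order signs of all pairs of entries.
  Distinctness makes these signs antisymmetric, so \<open>prod_pairs_permute\<close> applies, with
  factor -1 for a transposition.\<close>

lemma inversions_transpose:
  assumes u: "distinct u" and ab: "a < length u" "b < length u" "a \<noteq> b"
  shows "even (card (inversions (permute_list (transpose a b) u))) \<longleftrightarrow> odd (card (inversions u))"
proof -
  let ?n = "length u" and ?\<sigma> = "transpose a b"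
  have \<sigma>: "?\<sigma> permutes {..<?n}" using ab by (intro permutes_swap_id) auto
  define g where "g i j = (if u ! j < u ! i then - 1 else (1::int))" for i j
  have anti: "g j i = - g i j" if "i < ?n" "j < ?n" "i \<noteq> j" for i j
    using that nth_eq_iff_index_eq[OF u, of i j] by (auto simp: g_def)
  have "{(i, j)\<in>pairs ?n. ?\<sigma> j < ?\<sigma> i} = {(i, j)\<in>pairs ?n. transpose (min a b) (max a b) j < transpose (min a b) (max a b) i}"
    by (simp add: min_def max_def transpose_commute)
  then have "odd (card {(i, j)\<in>pairs ?n. ?\<sigma> j < ?\<sigma> i})"
    using card_transpose_inversions[of "min a b" "max a b" ?n] ab by simp
  then have \<sigma>_prod: "(\<Prod>(i, j)\<in>pairs ?n. if ?\<sigma> j < ?\<sigma> i then - 1 else 1) = (- 1 :: int)"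
    unfolding prod_neg_one[OF finite_pairs] minus_one_power_iff by (simp only: if_False)
  have inv_prod: "(\<Prod>(i, j)\<in>pairs (length w). if w ! j < w ! i then - 1 else 1) = (- 1 :: int) ^ card (inversions w)"
    for w :: "'a list"
    by (simp only: prod_neg_one[OF finite_pairs] inversions_def)
  have "(- 1 :: int) ^ card (inversions (permute_list ?\<sigma> u)) = (\<Prod>(i, j)\<in>pairs ?n. g (?\<sigma> i) (?\<sigma> j))"
    unfolding inv_prod[symmetric]
    by (rule prod.cong) (auto simp: pairs_def g_def permute_list_nth[OF \<sigma>])
  also have "\<dots> = (\<Prod>(i, j)\<in>pairs ?n. if ?\<sigma> j < ?\<sigma> i then - 1 else 1) * (\<Prod>(i, j)\<in>pairs ?n. g i j)"
    by (rule prod_pairs_permute[OF \<sigma>]) (rule anti)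
  also have "(\<Prod>(i, j)\<in>pairs ?n. g i j) = (- 1) ^ card (inversions u)"
    unfolding g_def by (rule inv_prod)
  also note \<sigma>_prod
  finally show ?thesis by (auto simp: minus_one_power_iff split: if_splits)
qed

lemma distinct_permute_list:
  assumes "\<sigma> permutes {..<length u}"
  shows "distinct (permute_list \<sigma> u) \<longleftrightarrow> distinct u"
  using mset_permute_list[OF assms] mset_eq_imp_distinct_iff by blast

lemma inversions_permute:
  assumes "\<sigma> permutes {..<n}" "length u = n" "distinct u"
  shows "even (card (inversions (permute_list \<sigma> u)) + card (inversions u)) \<longleftrightarrow> evenperm \<sigma>"
proof -
  \<comment> \<open>Quantified over all lists, because the induction step uses the hypothesis for
    the list already permuted by the transposition.\<close>
  have "\<forall>u :: 'a list. length u = n \<longrightarrow> distinct u \<longrightarrow>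
      (even (card (inversions (permute_list \<sigma> u)) + card (inversions u)) \<longleftrightarrow> evenperm \<sigma>)"
    using assms(1) finite_lessThan
  proof (induction rule: permutes_induct)
    case id
    then show ?case by (simp add: permute_list_id)
  next
    case (swap a b p)
    show ?case
    proof (cases "a = b")
      case True
      then show ?thesis using swap by simp
    next
      case False
      show ?thesis
      proof (intro allI impI)
        fix u :: "'a list" assume u: "length u = n" "distinct u"
        let ?t = "transpose a b"
        have t: "?t permutes {..<length u}" using swap u by (intro permutes_swap_id) auto
        have p: "p permutes {..<length u}" using swap u by simp
        have "permute_list (?t \<circ> p) u = permute_list p (permute_list ?t u)"
          by (rule permute_list_compose[OF p])
        moreover have "even (card (inversions (permute_list p (permute_list ?t u)))
            + card (inversions (permute_list ?t u))) \<longleftrightarrow> evenperm p"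
          using swap u distinct_permute_list[OF t] by simp
        moreover have "even (card (inversions (permute_list ?t u))) \<longleftrightarrow> odd (card (inversions u))"
          by (rule inversions_transpose) (use swap u False in auto)
        moreover have "evenperm (?t \<circ> p) \<longleftrightarrow> \<not> evenperm p"
          using p False evenperm_comp[OF permutation_swap_id[of a b] permutation_permutes[THEN iffD2]]
          by (metis evenperm_swap finite_lessThan)
        ultimately show "even (card (inversions (permute_list (?t \<circ> p) u)) + card (inversions u))
            \<longleftrightarrow> evenperm (?t \<circ> p)"
          by (cases "evenperm p"; cases "odd (card (inversions u))") simp_all
      qed
    qed
  qed
  then show ?thesis using assms(2,3) by blast
qed

lemma length_delete: "i < length v \<Longrightarrow> length (delete i v) = length v - 1"
  by (simp add: delete_def)

lemma nth_delete:
  "i < length v \<Longrightarrow> j < length v - 1 \<Longrightarrow> delete i v ! j = (if j < i then v ! j else v ! Suc j)"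
  by (auto simp: delete_def nth_append min_def)

lemma mset_delete: "i < length v \<Longrightarrow> mset v = add_mset (v ! i) (mset (delete i v))"
  by (subst id_take_nth_drop[of i v]) (simp_all add: delete_def)

lemma set_delete:
  assumes "distinct v" "i < length v" shows "set (delete i v) = set v - {v ! i}" "distinct (delete i v)"
proof -
  have v: "v = take i v @ v ! i # drop (Suc i) v" using assms(2) by (rule id_take_nth_drop)
  have "distinct (take i v @ v ! i # drop (Suc i) v)" using assms(1) v by simp
  moreover have "set v = insert (v ! i) (set (delete i v))" by (subst v) (auto simp: delete_def)
  ultimately show "set (delete i v) = set v - {v ! i}" "distinct (delete i v)"
    by (auto simp: delete_def)
qed

lemma inversions_delete:
  assumes i: "i < length v"
  shows "card (inversions v) = card (inversions (delete i v))
    + card {m. m < i \<and> v ! i < v ! m} + card {m. i < m \<and> m < length v \<and> v ! m < v ! i}"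
proof -
  \<comment> \<open>\<open>d\<close> sends a position in \<open>delete i v\<close> to the position
    in \<open>v\<close> that it came from.\<close>
  define d where "d k = (if k < i then k else Suc k)" for k
  define A where "A = {m. m < i \<and> v ! i < v ! m}"
  define B where "B = {m. i < m \<and> m < length v \<and> v ! m < v ! i}"
  define X where "X = map_prod d d ` inversions (delete i v)"
  have mono: "d k < d l \<longleftrightarrow> k < l" for k l by (auto simp: d_def)
  have d_ne: "d k \<noteq> i" for k by (auto simp: d_def)
  have d_nth: "delete i v ! k = v ! d k" if "k < length v - 1" for k
    using nth_delete[OF i that] by (auto simp: d_def)
  have d_lt: "d k < length v \<longleftrightarrow> k < length v - 1" for k using i by (auto simp: d_def)
  have d_surj: "\<exists>k. m = d k" if "m \<noteq> i" for m
    using that by (intro exI[of _ "if m < i then m else m - 1"]) (auto simp: d_def)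
  have inX: "(d k, d l) \<in> inversions v \<longleftrightarrow> (k, l) \<in> inversions (delete i v)" for k l
    using mono[of k l] d_lt[of l] d_nth[of k] d_nth[of l] length_delete[OF i]
    by (auto simp: inversions_def pairs_def)
  have "inversions v = X \<union> ((\<lambda>m. (m, i)) ` A \<union> Pair i ` B)" (is "_ = ?R")
  proof
    show "inversions v \<subseteq> ?R"
    proof
      fix p assume p: "p \<in> inversions v"
      obtain k l where kl: "p = (k, l)" by (cases p)
      show "p \<in> ?R"
      proof (cases "k = i \<or> l = i")
        case True
        then show ?thesis using p by (auto simp: kl inversions_def pairs_def A_def B_def)
      next
        case False
        then obtain k' l' where kl': "k = d k'" "l = d l'" using d_surj by blast
        then have "(k', l') \<in> inversions (delete i v)" using p inX by (simp add: kl)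
        then have "map_prod d d (k', l') \<in> X" unfolding X_def by (rule imageI)
        then show ?thesis by (simp add: kl kl')
      qed
    qed
    show "?R \<subseteq> inversions v"
      using inX i by (auto simp: X_def A_def B_def) (auto simp: inversions_def pairs_def)
  qed
  moreover have "card (X \<union> ((\<lambda>m. (m, i)) ` A \<union> Pair i ` B)) = card X + card ((\<lambda>m. (m, i)) ` A \<union> Pair i ` B)"
  proof (rule card_Un_disjoint)
    show "X \<inter> ((\<lambda>m. (m, i)) ` A \<union> Pair i ` B) = {}" using d_ne by (auto simp: X_def)
  qed (simp_all add: X_def A_def B_def)
  moreover have "card ((\<lambda>m. (m, i)) ` A \<union> Pair i ` B) = card ((\<lambda>m. (m, i)) ` A) + card (Pair i ` B)"
    by (rule card_Un_disjoint) (auto simp: A_def B_def)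
  moreover have "card X = card (inversions (delete i v))"
  proof -
    have "inj d" using mono by (metis injI less_irrefl linorder_neqE_nat)
    then have "inj (map_prod d d)" by (simp add: prod.inj_map)
    then show ?thesis unfolding X_def by (intro card_image) (rule inj_on_subset[OF _ subset_UNIV])
  qed
  moreover have "card ((\<lambda>m. (m, i)) ` A) = card A" "card (Pair i ` B) = card B"
    by (auto intro!: card_image simp: inj_on_def)
  ultimately show ?thesis unfolding A_def B_def by simp
qed

text \<open>The earlier entries are larger (\<open>A\<close>) or smaller (\<open>A'\<close>), and
  the later smaller ones form \<open>B\<close>. Position \<open>i\<close> counts \<open>A\<close>
  and \<open>A'\<close>, \<open>below\<close> counts \<open>A'\<close> and \<open>B\<close>, and the
  lost inversions are \<open>A\<close> and \<open>B\<close>, so everything is counted twice.\<close>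

lemma inversions_delete_distinct:
  assumes v: "distinct v" and i: "i < length v"
  shows "even (i + card (inversions (delete i v)) + card (inversions v) + below (v ! i) (set v))"
proof -
  define A where "A = {m. m < i \<and> v ! i < v ! m}"
  define A' where "A' = {m. m < i \<and> v ! m < v ! i}"
  define B where "B = {m. i < m \<and> m < length v \<and> v ! m < v ! i}"
  have "v ! m \<noteq> v ! i" if "m < i" for m using nth_eq_iff_index_eq[OF v, of m i] i that by simp
  then have "{..<i} = A \<union> A'" unfolding A_def A'_def neq_iff by blast
  moreover have "card (A \<union> A') = card A + card A'"
    by (rule card_Un_disjoint) (auto simp: A_def A'_def)
  ultimately have i_eq: "i = card A + card A'" by (metis card_lessThan)
  have "{j \<in> set v. j < v ! i} = (!) v ` (A' \<union> B)"
  proof (intro equalityI subsetI)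
    fix j assume "j \<in> {j \<in> set v. j < v ! i}"
    then obtain m where m: "m < length v" "j = v ! m" "v ! m < v ! i" by (auto simp: in_set_conv_nth)
    then have "m \<noteq> i" by auto
    then have "m \<in> A' \<union> B" using m by (auto simp: A'_def B_def)
    then show "j \<in> (!) v ` (A' \<union> B)" using m by blast
  qed (use i in \<open>auto simp: A'_def B_def\<close>)
  moreover have "inj_on ((!) v) (A' \<union> B)"
    using i by (intro inj_on_nth[OF v]) (auto simp: A'_def B_def)
  moreover have "card (A' \<union> B) = card A' + card B"
    by (rule card_Un_disjoint) (auto simp: A'_def B_def)
  ultimately have "below (v ! i) (set v) = card A' + card B" by (simp add: below_def card_image)
  moreover have "card (inversions v) = card (inversions (delete i v)) + card A + card B"
    unfolding A_def B_def by (rule inversions_delete[OF i])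
  ultimately have "i + card (inversions (delete i v)) + card (inversions v) + below (v ! i) (set v)
      = 2 * (card A + card A' + card B + card (inversions (delete i v)))"
    using i_eq by simp
  then show ?thesis by (metis dvd_triv_left)
qed

text \<open>The two deletions differ by moving one entry past the \<open>j - i - 1\<close> entries
  between. None of these equals it, so each of them changes the inversion count by one.\<close>

lemma inversions_delete_equal:
  assumes ij: "i < j" "j < length v" "v ! i = v ! j" and d: "distinct (delete i v)"
  shows "odd (i + card (inversions (delete i v)) + (j + card (inversions (delete j v))))"
proof -
  define a where "a = v ! i"
  define A where "A k = {m. m < k \<and> a < v ! m}" for k
  define B where "B k = {m. k < m \<and> m < length v \<and> v ! m < a}" for k
  define P where "P = {m. i < m \<and> m < j \<and> a < v ! m}"
  define Q where "Q = {m. i < m \<and> m < j \<and> v ! m < a}"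
  have ne: "v ! m \<noteq> a" if m: "i < m" "m < j" for m
  proof
    assume eq: "v ! m = a"
    have i: "i < length v" using ij by simp
    have "delete i v ! (m - 1) = v ! m" "delete i v ! (j - 1) = v ! j"
      using ij m nth_delete[OF i, of "m - 1"] nth_delete[OF i, of "j - 1"] by auto
    moreover have "delete i v ! (m - 1) \<noteq> delete i v ! (j - 1)"
      using nth_eq_iff_index_eq[OF d, of "m - 1" "j - 1"] ij m length_delete[OF i] by auto
    ultimately show False using eq ij(3) by (simp add: a_def)
  qed
  have "A j = A i \<union> P"
  proof -
    have "m \<in> A i \<union> P" if "m \<in> A j" for m
    proof -
      have "m \<noteq> i" using that by (auto simp: A_def a_def)
      then show ?thesis using that by (auto simp: A_def P_def)
    qed
    then show ?thesis using ij by (auto simp: A_def P_def)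
  qed
  moreover have "card (A i \<union> P) = card (A i) + card P"
    by (rule card_Un_disjoint) (auto simp: A_def P_def)
  moreover have "B i = B j \<union> Q"
  proof -
    have "m \<in> B j \<union> Q" if "m \<in> B i" for m
    proof -
      have "m \<noteq> j" using that ij(3) by (auto simp: B_def a_def)
      then show ?thesis using that by (auto simp: B_def Q_def)
    qed
    then show ?thesis using ij by (auto simp: B_def Q_def)
  qed
  moreover have "card (B j \<union> Q) = card (B j) + card Q"
    by (rule card_Un_disjoint) (auto simp: B_def Q_def)
  moreover have "card P + card Q = j - i - 1"
  proof -
    have "{i<..<j} = P \<union> Q" using ne by (auto simp: P_def Q_def) (meson linorder_neqE)
    moreover have "card (P \<union> Q) = card P + card Q"
      by (rule card_Un_disjoint) (auto simp: P_def Q_def)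
    ultimately show ?thesis by (metis card_greaterThanLessThan diff_Suc_eq_diff_pred diff_commute diff_Suc_1 One_nat_def)
  qed
  moreover have "card (inversions v) = card (inversions (delete i v)) + card (A i) + card (B i)"
    using inversions_delete[of i v] ij by (simp add: A_def B_def a_def)
  moreover have "card (inversions v) = card (inversions (delete j v)) + card (A j) + card (B j)"
    using inversions_delete[of j v] ij by (simp add: A_def B_def a_def)
  moreover have "card P + card Q + i + 1 = j" using ij(1) calculation(5) by simp
  ultimately have "i + card (inversions (delete i v)) + (j + card (inversions (delete j v)))
      = 2 * (i + card (inversions (delete i v)) + card Q) + 1"
    by simp
  then show ?thesis by presburger
qed

section \<open>From families on finite sets to alternating families\<close>

definition list_family :: "('i::linorder set \<Rightarrow> 'a \<Rightarrow> 'g::ab_group_add) \<Rightarrow> 'i list \<Rightarrow> 'a \<Rightarrow> 'g" where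
  "list_family \<Phi> u z = (if distinct u then sgm (card (inversions u)) (\<Phi> (set u) z) else 0)"

lemma alternating_list_family: "alternating UNIV x n (list_family \<Phi>)"
  unfolding alternating_def
proof (intro ballI allI impI)
  fix u :: "'a list" and \<sigma> z assume "u \<in> tuples UNIV n" and \<sigma>: "\<sigma> permutes {..<n}"
  then have n: "length u = n" by (simp add: tuples_def)
  then have \<sigma>': "\<sigma> permutes {..<length u}" using \<sigma> by simp
  show "list_family \<Phi> (permute_list \<sigma> u) z
      = (if evenperm \<sigma> then list_family \<Phi> u z else - list_family \<Phi> u z)"
    using inversions_permute[OF \<sigma> n]
    by (auto simp: list_family_def distinct_permute_list[OF \<sigma>'] set_permute_list[OF \<sigma>'] sgm_def)
qed

lemma alt_sum_sgm: "alt_sum \<Phi> v z = (\<Sum>i<length v. sgm i (\<Phi> (delete i v) z))"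
  by (simp add: alt_sum_def sgm_def)

text \<open>Without repetitions, \<open>inversions_delete_distinct\<close> matches the signs of the
  two coboundaries. If two entries agree, only the faces that drop one of them can be free of
  repetitions, and these cancel by \<open>inversions_delete_equal\<close>.\<close>

lemma alt_sum_list_family:
  "alt_sum (list_family \<Phi>) v z
    = (if distinct v then sgm (card (inversions v)) (cob \<Phi> (set v) z) else 0)"
proof (cases "distinct v")
  case True
  have "alt_sum (list_family \<Phi>) v z
      = (\<Sum>i<length v. sgm (card (inversions v)) (sgm (below (v ! i) (set v)) (\<Phi> (set v - {v ! i}) z)))"
    unfolding alt_sum_sgm
  proof (rule sum.cong[OF refl])
    fix i assume "i \<in> {..<length v}"
    then have i: "i < length v" by simp
    have "even (i + card (inversions (delete i v)) + (card (inversions v) + below (v ! i) (set v)))"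
      using inversions_delete_distinct[OF True i] by (simp only: add.assoc)
    then have "sgm (i + card (inversions (delete i v))) (\<Phi> (set v - {v ! i}) z)
        = sgm (card (inversions v) + below (v ! i) (set v)) (\<Phi> (set v - {v ! i}) z)"
      by (rule sgm_parity)
    then show "sgm i (list_family \<Phi> (delete i v) z)
        = sgm (card (inversions v)) (sgm (below (v ! i) (set v)) (\<Phi> (set v - {v ! i}) z))"
      by (simp add: list_family_def set_delete[OF True i])
  qed
  also have "\<dots> = (\<Sum>c\<in>set v. sgm (card (inversions v)) (sgm (below c (set v)) (\<Phi> (set v - {c}) z)))"
    using sum.reindex_bij_betw[OF bij_betw_nth[OF True refl refl]] .
  finally show ?thesis using True by (simp add: cob_def sgm_sum)
next
  case False
  then obtain i j where ij: "i < length v" "j < length v" "i \<noteq> j" "v ! i = v ! j"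
    by (auto simp: distinct_conv_nth)
  obtain i j where ij: "i < j" "j < length v" "v ! i = v ! j"
    using ij by (metis linorder_neqE_nat)
  have i: "i < length v" using ij by simp
  have m: "mset (delete i v) = mset (delete j v)"
    using mset_delete[OF i] mset_delete[OF ij(2)] ij(3) by simp
  have zero: "list_family \<Phi> (delete k v) z = 0" if k: "k < length v" "k \<noteq> i" "k \<noteq> j" for k
  proof -
    have "\<not> distinct (delete k v)"
    proof
      assume d: "distinct (delete k v)"
      define s where "s l = (if l < k then l else l - 1)" for l
      have s: "delete k v ! s l = v ! l" "s l < length (delete k v)" if "l < length v" "l \<noteq> k" for l
        using nth_delete[OF k(1), of "s l"] length_delete[OF k(1)] that k(1) by (auto simp: s_def)
      have "delete k v ! s i = delete k v ! s j" using s(1) ij(2,3) i k by simp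
      then have "s i = s j" using nth_eq_iff_index_eq[OF d] s(2) ij(2) i k by simp
      then show False using ij k by (auto simp: s_def split: if_splits)
    qed
    then show ?thesis by (simp add: list_family_def)
  qed
  have "alt_sum (list_family \<Phi>) v z = (\<Sum>k\<in>{i, j}. sgm k (list_family \<Phi> (delete k v) z))"
    unfolding alt_sum_sgm by (rule sum.mono_neutral_right) (use i ij zero in auto)
  also have "\<dots> = sgm i (list_family \<Phi> (delete i v) z) + sgm j (list_family \<Phi> (delete j v) z)"
    using ij(1) by simp
  also have "\<dots> = 0"
  proof (cases "distinct (delete i v)")
    case True
    moreover have "distinct (delete j v)" "set (delete j v) = set (delete i v)"
      using m True mset_eq_imp_distinct_iff mset_eq_setD by metis+
    moreover have "odd (i + card (inversions (delete i v)) + (j + card (inversions (delete j v))))"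
      by (rule inversions_delete_equal[OF ij True])
    ultimately show ?thesis by (auto simp: list_family_def sgm_def)
  next
    case False
    moreover have "\<not> distinct (delete j v)" using m False mset_eq_imp_distinct_iff by metis
    ultimately show ?thesis by (simp add: list_family_def)
  qed
  finally show ?thesis using \<open>\<not> distinct v\<close> by simp
qed

lemma dm_eq: "dm x u = dom_on x UNIV (set u)"
  by (auto simp: dm_def dom_on_def all_set_conv_all_nth)

lemma coherent_list_family:
  assumes "coh x UNIV UNIV n \<Phi>"
  shows "coherent UNIV x n (list_family \<Phi>)"
  unfolding coherent_def
proof (intro conjI ballI alternating_list_family)
  fix v :: "'a list" assume v: "v \<in> tuples UNIV (n + 1)"
  show "eq_mod_finite (dm x v) (alt_sum (list_family \<Phi>) v) (\<lambda>_. 0)"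
  proof (cases "distinct v")
    case True
    then have "set v \<in> fsub UNIV (Suc n)" using v by (simp add: fsub_def tuples_def distinct_card)
    then have "finite {z\<in>dom_on x UNIV (set v). cob \<Phi> (set v) z \<noteq> 0}" using assms by (simp add: coh_def)
    then show ?thesis using True by (simp add: eq_mod_finite_def alt_sum_list_family dm_eq)
  qed (simp add: eq_mod_finite_def alt_sum_list_family)
qed

lemma inversions_sorted:
  assumes "sorted u" shows "inversions u = {}"
proof -
  have "\<not> u ! j < u ! i" if "i < j" "j < length u" for i j
    using sorted_nth_mono[OF assms, of i j] that by (simp add: not_less)
  then show ?thesis by (auto simp: inversions_def pairs_def)
qed

lemma delete_sorted_list_of_set:
  assumes F: "finite F" and i: "i < card F"
  defines "u \<equiv> sorted_list_of_set F"
  shows "delete i u = sorted_list_of_set (F - {u ! i})" "below (u ! i) F = i"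
proof -
  have u: "sorted_wrt (<) u" "distinct u" "set u = F" "length u = card F"
    using F by (simp_all add: u_def)
  have iu: "i < length u" using i u by simp
  have v: "u = take i u @ u ! i # drop (Suc i) u" using iu by (rule id_take_nth_drop)
  have "sorted_wrt (<) (take i u @ u ! i # drop (Suc i) u)" using u(1) v by simp
  then have "sorted_wrt (<) (delete i u)" by (auto simp: delete_def sorted_wrt_append)
  then have "sorted (delete i u)" by (rule strict_sorted_imp_sorted)
  then have "sorted_list_of_set (set (delete i u)) = delete i u"
    using set_delete(2)[OF u(2) iu] by (simp add: sorted_list_of_set.idem_if_sorted_distinct)
  then show "delete i u = sorted_list_of_set (F - {u ! i})"
    using set_delete(1)[OF u(2) iu] u(3) by simp
  have "{j \<in> F. j < u ! i} = (!) u ` {..<i}"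
  proof (intro equalityI subsetI)
    fix j assume "j \<in> {j \<in> F. j < u ! i}"
    then obtain m where m: "m < length u" "j = u ! m" "u ! m < u ! i"
      using u(3) by (auto simp: in_set_conv_nth)
    then have "m < i" using sorted_wrt_nth_less[OF u(1), of i m] iu by (metis linorder_neqE_nat order_less_asym order_less_irrefl)
    then show "j \<in> (!) u ` {..<i}" using m by blast
  next
    fix j assume "j \<in> (!) u ` {..<i}"
    then show "j \<in> {j \<in> F. j < u ! i}"
      using sorted_wrt_nth_less[OF u(1)] iu u(3) nth_mem[of _ u] by auto
  qed
  moreover have "inj_on ((!) u) {..<i}" using iu by (intro inj_on_nth[OF u(2)]) auto
  ultimately show "below (u ! i) F = i" by (simp add: below_def card_image)
qed

lemma alt_sum_sorted:
  assumes F: "finite F"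
  shows "alt_sum \<Psi> (sorted_list_of_set F) z = cob (\<lambda>F. \<Psi> (sorted_list_of_set F)) F z"
proof -
  let ?u = "sorted_list_of_set F"
  have "alt_sum \<Psi> ?u z = (\<Sum>i<length ?u. sgm (below (?u ! i) F) (\<Psi> (sorted_list_of_set (F - {?u ! i})) z))"
    unfolding alt_sum_sgm
    by (rule sum.cong[OF refl]) (simp add: delete_sorted_list_of_set[OF F])
  also have "\<dots> = (\<Sum>c\<in>F. sgm (below c F) (\<Psi> (sorted_list_of_set (F - {c})) z))"
    by (rule sum.reindex_bij_betw[OF bij_betw_nth]) (use F in simp_all)
  finally show ?thesis by (simp add: cob_def)
qed

text \<open>On sorted lists no signs occur, so restricting a trivialization to them gives one for
  \<open>\<Phi>\<close>. For \<open>n = 1\<close> the single function serves as the value at the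
  empty set.\<close>

lemma triv_if_trivial_list_family:
  fixes \<Phi> :: "'i::linorder set \<Rightarrow> 'a \<Rightarrow> 'g::ab_group_add"
  assumes "trivial_family UNIV x n (list_family \<Phi>)"
  shows "triv x UNIV UNIV n \<Phi>"
proof -
  obtain \<psi> :: "'i set \<Rightarrow> 'a \<Rightarrow> 'g" where
    \<psi>: "\<And>F. F \<in> fsub UNIV n \<Longrightarrow>
      finite {z\<in>dm x (sorted_list_of_set F). list_family \<Phi> (sorted_list_of_set F) z \<noteq> cob \<psi> F z}"
  proof (cases "n = 1")
    case True
    then obtain \<psi> :: "'a \<Rightarrow> 'g" where \<psi>: "\<And>\<alpha>. finite {z\<in>x \<alpha>. \<psi> z \<noteq> list_family \<Phi> [\<alpha>] z}"
      using assms by (auto simp: trivial_family_def eq_mod_finite_def)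
    show thesis
    proof (rule that[of "\<lambda>F. \<psi>"])
      fix F :: "'i set" assume "F \<in> fsub UNIV n"
      then obtain \<alpha> where \<alpha>: "F = {\<alpha>}" using True by (auto simp: fsub_def card_1_singleton_iff)
      have "cob (\<lambda>F. \<psi>) {\<alpha>} z = \<psi> z" for z
      proof -
        have "{j \<in> {\<alpha>}. j < \<alpha>} = {}" by auto
        then have "below \<alpha> {\<alpha>} = 0" unfolding below_def by simp
        then show ?thesis by (simp add: cob_def sgm_def)
      qed
      moreover have "{z\<in>x \<alpha>. list_family \<Phi> [\<alpha>] z \<noteq> \<psi> z} = {z\<in>x \<alpha>. \<psi> z \<noteq> list_family \<Phi> [\<alpha>] z}" by auto
      ultimately show "finite {z\<in>dm x (sorted_list_of_set F). list_family \<Phi> (sorted_list_of_set F) z \<noteq> cob (\<lambda>F. \<psi>) F z}"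
        using \<psi>[of \<alpha>] by (simp add: \<alpha> dm_eq dom_on_def)
    qed
  next
    case False
    then obtain \<Psi> :: "'i list \<Rightarrow> 'a \<Rightarrow> 'g" where
      \<Psi>: "\<And>u. u \<in> tuples UNIV n \<Longrightarrow> finite {z\<in>dm x u. list_family \<Phi> u z \<noteq> alt_sum \<Psi> u z}"
      using assms by (auto simp: trivial_family_def eq_mod_finite_def)
    show thesis
    proof (rule that[of "\<lambda>F. \<Psi> (sorted_list_of_set F)"])
      fix F :: "'i set" assume "F \<in> fsub UNIV n"
      then have "finite F" "sorted_list_of_set F \<in> tuples UNIV n" by (auto simp: fsub_def tuples_def)
      then show "finite {z\<in>dm x (sorted_list_of_set F). list_family \<Phi> (sorted_list_of_set F) z
          \<noteq> cob (\<lambda>F. \<Psi> (sorted_list_of_set F)) F z}"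
        using \<Psi>[of "sorted_list_of_set F"] by (simp add: alt_sum_sorted)
    qed
  qed
  have "finite {z\<in>dom_on x UNIV F. \<Phi> F z \<noteq> cob \<psi> F z}" if F: "F \<in> fsub UNIV n" for F
  proof -
    have "finite F" using F by (simp add: fsub_def)
    then have "list_family \<Phi> (sorted_list_of_set F) z = \<Phi> F z" for z
      by (simp add: list_family_def inversions_sorted sgm_def)
    then show ?thesis using \<psi>[OF F] \<open>finite F\<close> by (simp add: dm_eq)
  qed
  then show ?thesis unfolding triv_def by blast
qed

section \<open>Coordinates and the main theorem\<close>

text \<open>Through an injective \<open>p\<close> the positions \<open>p (d, j)\<close> form the row
  of \<open>d\<close>, and each row is a copy of the whole sum. \<open>proj\<close> reads a row;
  \<open>embed\<close> fills it and puts 0 everywhere else, also outside the range of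
  \<open>p\<close>.\<close>

definition proj :: "('i \<times> 'i \<Rightarrow> 'i) \<Rightarrow> 'i \<Rightarrow> ('i \<Rightarrow>\<^sub>0 'h) \<Rightarrow> ('i \<Rightarrow>\<^sub>0 'h::ab_group_add)" where
  "proj p d g = Abs_poly_mapping (\<lambda>j. Poly_Mapping.lookup g (p (d, j)))"

definition embed :: "('i \<times> 'i \<Rightarrow> 'i) \<Rightarrow> 'i \<Rightarrow> ('i \<Rightarrow>\<^sub>0 'h) \<Rightarrow> ('i \<Rightarrow>\<^sub>0 'h::ab_group_add)" where
  "embed p d g = Abs_poly_mapping (\<lambda>i. if \<exists>j. i = p (d, j) then Poly_Mapping.lookup g (snd (inv p i)) else 0)"

lemma lookup_proj:
  assumes "inj p" shows "Poly_Mapping.lookup (proj p d g) j = Poly_Mapping.lookup g (p (d, j))"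
proof -
  have "inj (\<lambda>j. p (d, j))" by (simp add: inj_on_def inj_eq[OF assms])
  then have "finite ((\<lambda>j. p (d, j)) -` {i. Poly_Mapping.lookup g i \<noteq> 0})"
    using finite_lookup[of g] by (rule finite_vimageI[rotated])
  then have "finite {j. Poly_Mapping.lookup g (p (d, j)) \<noteq> 0}" by (simp add: vimage_def)
  then show ?thesis by (simp add: proj_def)
qed

lemma lookup_embed:
  assumes "inj p"
  shows "Poly_Mapping.lookup (embed p d g) i = (if \<exists>j. i = p (d, j) then Poly_Mapping.lookup g (snd (inv p i)) else 0)"
proof -
  have "{i. (if \<exists>j. i = p (d, j) then Poly_Mapping.lookup g (snd (inv p i)) else 0) \<noteq> 0}
      \<subseteq> (\<lambda>j. p (d, j)) ` {j. Poly_Mapping.lookup g j \<noteq> 0}"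
    using inv_f_f[OF assms] by (auto split: if_splits)
  then have "finite {i. (if \<exists>j. i = p (d, j) then Poly_Mapping.lookup g (snd (inv p i)) else 0) \<noteq> 0}"
    using finite_lookup[of g] finite_subset by blast
  then show ?thesis by (simp add: embed_def)
qed

lemma finite_proj:
  assumes "inj p" shows "finite {d. proj p d g \<noteq> 0}"
proof (rule finite_subset)
  show "{d. proj p d g \<noteq> 0} \<subseteq> (\<lambda>i. fst (inv p i)) ` {i. Poly_Mapping.lookup g i \<noteq> 0}"
  proof
    fix d assume "d \<in> {d. proj p d g \<noteq> 0}"
    then have "proj p d g \<noteq> 0" by simp
    then obtain j where "Poly_Mapping.lookup (proj p d g) j \<noteq> 0" by (metis poly_mapping_eqI lookup_zero)
    then have "Poly_Mapping.lookup g (p (d, j)) \<noteq> 0" by (simp add: lookup_proj[OF assms])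
    moreover have "d = fst (inv p (p (d, j)))" by (simp add: inv_f_f[OF assms])
    ultimately show "d \<in> (\<lambda>i. fst (inv p i)) ` {i. Poly_Mapping.lookup g i \<noteq> 0}" by blast
  qed
  show "finite ((\<lambda>i. fst (inv p i)) ` {i. Poly_Mapping.lookup g i \<noteq> 0})" by simp
qed

lemma proj_embed:
  assumes "inj p" shows "proj p d (embed p d g) = g"
proof (rule poly_mapping_eqI)
  fix j
  have "\<exists>l. p (d, j) = p (d, l)" by blast
  then show "Poly_Mapping.lookup (proj p d (embed p d g)) j = Poly_Mapping.lookup g j"
    by (simp only: lookup_proj[OF assms] lookup_embed[OF assms] inv_f_f[OF assms] if_True snd_conv)
qed

lemma proj_add:
  assumes "inj p" shows "proj p d (g + h) = proj p d g + proj p d h"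
  by (rule poly_mapping_eqI) (simp add: lookup_proj[OF assms] lookup_add)

lemma embed_add:
  assumes "inj p" shows "embed p d (g + h) = embed p d g + embed p d h"
  by (rule poly_mapping_eqI) (simp add: lookup_embed[OF assms] lookup_add)

section \<open>From an ascending sequence to a ladder\<close>

lemma is_omega_alephs:
  "is_omega n (r :: 'k rel) \<Longrightarrow> \<exists>k. k n = r \<and> k 0 =o natLeq \<and> (\<forall>m<n. k (Suc m) =o cardSuc (k m))"
proof (induction n arbitrary: r)
  case 0
  then show ?case by (intro exI[of _ "\<lambda>_. r"]) simp
next
  case (Suc n)
  have "\<exists>s :: 'k rel. is_omega n s \<and> r =o cardSuc s" using Suc.prems by simp
  then obtain s :: "'k rel" where s: "is_omega n s" "r =o cardSuc s" by blast
  then obtain k where k: "k n = s" "k 0 =o natLeq" "\<forall>m<n. k (Suc m) =o cardSuc (k m)"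
    using Suc.IH by blast
  then show ?case
    using s(2) by (intro exI[of _ "k(Suc n := r)"]) (auto simp: less_Suc_eq)
qed

text \<open>Forgetting the values of \<open>w\<close> yields sets indexed by finite sets of indices,
  as \<open>hull\<close> requires; they stay countable, since a finite domain carries finitely many
  \<open>w\<close>.\<close>

definition witness_sets :: "(('i \<rightharpoonup> bool) \<Rightarrow> 'a set) \<Rightarrow> 'i set \<Rightarrow> 'a set" where
  "witness_sets e b = \<Union> (e ` {w \<in> Fn_plus UNIV. dom w = b})"

lemma countable_witness_sets:
  assumes w: "witness_ascending UNIV x e C" and "finite b"
  shows "countable (witness_sets e b)"
proof -
  have "{w :: 'a \<rightharpoonup> bool. dom w = b} = {w. dom w = b \<and> ran w \<subseteq> UNIV}" by auto
  moreover have "finite {w :: 'a \<rightharpoonup> bool. dom w = b \<and> ran w \<subseteq> UNIV}"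
    using \<open>finite b\<close> by (rule finite_set_of_finite_maps) simp
  ultimately have "finite {w :: 'a \<rightharpoonup> bool. dom w = b}" by simp
  then have "finite {w \<in> Fn_plus UNIV :: ('a \<rightharpoonup> bool) set. dom w = b}" by (rule rev_finite_subset) auto
  moreover have "countable (e w)" if "w \<in> Fn_plus UNIV" for w
    using bspec[OF conjunct1[OF conjunct2[OF w[unfolded witness_ascending_def]]] that]
    by (simp split: if_splits)
  ultimately show ?thesis unfolding witness_sets_def by (intro countable_UN) (auto intro: countable_finite)
qed

lemma hull_witness_sets: "hull (witness_sets e) A \<subseteq> (\<Union>w\<in>Fn_plus A. e w)"
proof
  fix z assume "z \<in> hull (witness_sets e) A"
  then obtain b w where "b \<subseteq> A" "w \<in> Fn_plus UNIV" "dom w = b" "z \<in> e w"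
    unfolding hull_def witness_sets_def by blast
  then have "w \<in> Fn_plus A" by (simp add: Fn_plus_def)
  then show "z \<in> (\<Union>w\<in>Fn_plus A. e w)" using \<open>z \<in> e w\<close> by blast
qed

text \<open>Let \<open>w\<close> be 1 at \<open>\<beta>\<close> and 0 on \<open>b\<close>. Clause
  (b) of ascendingness says that \<open>w\<close> is respected, and clause (c) then keeps infinitely
  many points of \<open>e w\<close> in all the later sets.\<close>

lemma witness_pointwise:
  fixes x :: "'i::wellorder \<Rightarrow> 'a set"
  assumes wit: "witness_ascending UNIV x e C"
    and \<beta>: "\<beta> \<in> C" and b: "finite b" "b \<subseteq> {..<\<beta>}" and a: "finite a" "a \<subseteq> C" "\<forall>\<gamma>\<in>a. \<beta> < \<gamma>"
  shows "\<exists>z\<in>witness_sets e (insert \<beta> b). z \<in> x \<beta> \<and> (\<forall>\<gamma>\<in>a. z \<in> x \<gamma>) \<and> (\<forall>\<alpha>\<in>b. z \<notin> x \<alpha>)"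
proof -
  define w where "w i = (if i = \<beta> then Some True else if i \<in> b then Some False else None)" for i
  have w: "w -` {Some True} = {\<beta>}" "w -` {Some False} = b" "dom w = insert \<beta> b"
    using b(2) by (auto simp: w_def dom_def split: if_splits)
  then have wF: "w \<in> Fn_plus UNIV" using b(1) by (simp add: Fn_plus_def)
  note wits = wit[unfolded witness_ascending_def, THEN conjunct2, THEN conjunct2]
  have "infinite (x \<beta> - (\<Union>\<alpha>\<in>b. x \<alpha>))" using wits[THEN conjunct1] \<beta> b by simp
  then have resp: "respects_seq x w" by (simp add: respects_seq_def dset_def w)
  have "if respects_seq x w then e w \<subseteq> dset x w \<and> countable (e w) \<and> infinite (e w) else e w = {}"
    using conjunct1[OF conjunct2[OF wit[unfolded witness_ascending_def]]] wF by (rule bspec)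
  then have ew: "e w \<subseteq> dset x w" "infinite (e w)" using resp by simp_all
  have "infinite (e w \<inter> (\<Inter>\<gamma>\<in>a. x \<gamma>))"
  \<comment> \<open>Clause (c) speaks of \<open>Min a\<close>; for empty \<open>a\<close> the
    infinity of \<open>e w\<close> itself suffices.\<close>
  proof (cases "a = {}")
    case False
    have "\<beta> < Min a" using a False by simp
    then have "w \<in> Fn_plus (UNIV \<inter> {..<Min a})"
      using w b by (auto simp: Fn_plus_def)
    then show ?thesis
      using wits[THEN conjunct2] a False resp by simp
  qed (use ew in simp)
  then have "e w \<inter> (\<Inter>\<gamma>\<in>a. x \<gamma>) \<noteq> {}" by (metis finite.emptyI)
  then obtain z where z: "z \<in> e w" "\<forall>\<gamma>\<in>a. z \<in> x \<gamma>" by blast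
  moreover have "z \<in> x \<beta>" "\<forall>\<alpha>\<in>b. z \<notin> x \<alpha>" using ew(1) z(1) w by (auto simp: dset_def)
  moreover have "z \<in> witness_sets e (insert \<beta> b)"
    using z(1) wF w(3) unfolding witness_sets_def by blast
  ultimately show ?thesis by blast
qed

lemma supported_family:
  fixes x :: "'i::wellorder \<Rightarrow> 'a set" and g :: "'h::ab_group_add"
  assumes n: "1 \<le> n" and om: "is_omega n {(\<alpha>, \<beta>). \<alpha> \<le> (\<beta> :: 'i)}" and g: "g \<noteq> 0"
    and wit: "witness_ascending UNIV x e C"
  shows "\<exists>\<Phi> :: 'i list \<Rightarrow> 'a \<Rightarrow> ('i \<Rightarrow>\<^sub>0 'h). coherent UNIV x n \<Phi> \<and> \<not> trivial_family UNIV x n \<Phi>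
           \<and> supported_on UNIV x n e \<Phi>"
proof -
  define r where "r = {(\<alpha>, \<beta>). \<alpha> \<le> (\<beta> :: 'i)}"
  define lt where "lt = {(\<alpha>, \<beta>). \<alpha> < (\<beta> :: 'i)}"
  have "is_omega n r" using om unfolding r_def .
  from is_omega_alephs[OF this]
  obtain k where *: "k n = r \<and> k 0 =o natLeq \<and> (\<forall>m<n. k (Suc m) =o cardSuc (k m))" ..
  note k = *[THEN conjunct1] *[THEN conjunct2, THEN conjunct1] *[THEN conjunct2, THEN conjunct2]
  interpret A: alephs k n using k by unfold_locales auto
  have card_r: "Card_order r" using A.card_k[of n] k(1) by simp
  have field: "Field r = UNIV" by (auto simp: r_def Field_def)
  have "infinite (UNIV :: 'i set)" using A.infinite_k[of n] k(1) field by simp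
  then have "|UNIV \<times> UNIV :: ('i \<times> 'i) set| \<le>o |UNIV :: 'i set|"
    using card_of_Times_same_infinite ordIso_iff_ordLeq by blast
  then obtain p :: "'i \<times> 'i \<Rightarrow> 'i" where p: "inj p"
    unfolding card_of_ordLeq[symmetric] by auto
  interpret L: ladders k n x "witness_sets e" "proj p" "embed p :: 'i \<Rightarrow> ('i \<Rightarrow>\<^sub>0 'h) \<Rightarrow> _"
  proof
    show "\<exists>q :: 'i \<Rightarrow>\<^sub>0 'h. q \<noteq> 0"
    proof
      show "Poly_Mapping.single undefined g \<noteq> 0" using g by (metis lookup_single_eq lookup_zero)
    qed
  qed (simp_all add: proj_add[OF p] embed_add[OF p] proj_embed[OF p] finite_proj[OF p]
      countable_witness_sets[OF wit])
  have swo: "swo UNIV lt"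
    unfolding swo_def lt_def using wf by (auto simp: trans_def total_on_def)
  have seg: "seg lt \<beta> = {..<\<beta>}" for \<beta> by (auto simp: lt_def)
  have sm_seg: "A.sm n {..<\<beta>}" for \<beta> :: 'i
  proof (rule A.ordLess_k_sm)
    have "underS r \<beta> = {..<\<beta>}" by (auto simp: underS_def r_def)
    then show "|{..<\<beta>}| <o k n" using card_of_underS[OF card_r, of \<beta>] field k(1) by simp
  qed simp
  have not_sm: "\<not> A.sm n (UNIV :: 'i set)"
    using A.not_sm[of n "UNIV :: 'i set"] card_of_Field_ordIso[OF card_r] field k(1)
      ordIso_iff_ordLeq by fastforce
  have club: "club_in UNIV C" using wit by (simp add: witness_ascending_def)
  have "L.ladder n UNIV lt C UNIV"
    unfolding L.ladder_def seg
  proof (intro conjI allI ballI impI)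
    show "swo UNIV lt" by (rule swo)
    show "A.sm n {..<c}" for c :: 'i by (rule sm_seg)
    \<comment> \<open>By regularity, the closed initial segments given by a small \<open>B\<close>
      do not cover the type; a point \<open>\<gamma>\<close> that they miss is above all of
      \<open>B\<close>.\<close>
    show "\<exists>\<beta>\<in>C. B \<subseteq> {..<\<beta>}" if B: "A.sm n B" for B
    proof -
      have "A.sm n (\<Union>b\<in>B. insert b {..<b})"
        by (rule A.sm_UN[OF _ B A.sm_insert[OF _ sm_seg]]) simp_all
      then have "(\<Union>b\<in>B. insert b {..<b}) \<noteq> UNIV" using not_sm by metis
      then obtain \<gamma> where \<gamma>: "\<And>b. b \<in> B \<Longrightarrow> \<gamma> \<notin> insert b {..<b}" by blast
      obtain c where "c \<in> C" "\<gamma> \<le> c" using club unfolding club_in_def by blast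
      then have "B \<subseteq> {..<c}" using \<gamma> by force
      then show ?thesis using \<open>c \<in> C\<close> by blast
    qed
    show "\<beta> \<in> C" if "{..<\<beta>} \<noteq> {}" "\<forall>\<alpha>\<in>{..<\<beta>}. \<exists>c\<in>C. (\<alpha>, c) \<in> lt \<and> (c, \<beta>) \<in> lt" for \<beta>
      using club that unfolding club_in_def lt_def by simp
    show "\<exists>z\<in>witness_sets e (insert \<beta> b) \<inter> UNIV. z \<in> x \<beta> \<and> (\<forall>\<gamma>\<in>a. z \<in> x \<gamma>) \<and> (\<forall>\<alpha>\<in>b. z \<notin> x \<alpha>)"
      if "\<beta> \<in> C" "finite b" "b \<subseteq> {..<\<beta>}" "finite a" "a \<subseteq> C" "\<forall>\<gamma>\<in>a. (\<beta>, \<gamma>) \<in> lt" for \<beta> a b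
      using witness_pointwise[OF wit that(1-5)] that(6) by (simp add: lt_def)
  qed simp
  moreover obtain m where m: "n = Suc m" using n by (cases n) auto
  ultimately have L: "L.ladder (Suc m) UNIV lt C UNIV" by simp
  \<comment> \<open>\<open>ladder_good\<close> is used only one dimension down; the top dimension
    goes through \<open>ladder_Suc\<close>, to keep the stagewise support.\<close>
  have "\<forall>I r K U. L.ladder m I r K U \<longrightarrow> L.good m I U" using L.ladder_good[of m] m by simp
  moreover have "m \<le> n" using m by simp
  ultimately obtain \<Phi> :: "'i set \<Rightarrow> 'a \<Rightarrow> ('i \<Rightarrow>\<^sub>0 'h)" where *: "coh x UNIV UNIV (Suc m) \<Phi> \<and> \<not> triv x UNIV UNIV (Suc m) \<Phi>
      \<and> (\<forall>c\<in>UNIV. \<forall>G\<in>fsub (seg lt c) m. \<forall>z. \<Phi> (insert c G) z \<noteq> 0 \<longrightarrow> z \<in> hull (witness_sets e) (seg lt c))"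
    using L.ladder_Suc[OF L] by meson
  then have \<Phi>: "coh x UNIV UNIV n \<Phi>" "\<not> triv x UNIV UNIV n \<Phi>"
    and \<Phi>_supp: "\<And>c G z. G \<in> fsub {..<c} m \<Longrightarrow> \<Phi> (insert c G) z \<noteq> 0 \<Longrightarrow> z \<in> hull (witness_sets e) {..<c}"
    unfolding seg m by blast+
  have "supported_on UNIV x n e (list_family \<Phi>)"
    unfolding supported_on_def
  proof (intro ballI subsetI)
    fix u :: "'i list" and z
    assume u: "u \<in> tuples UNIV n" and z: "z \<in> {z \<in> dm x u. list_family \<Phi> u z \<noteq> 0}"
    let ?c = "Max (set u)"
    have d: "distinct u" "\<Phi> (set u) z \<noteq> 0" using z by (auto simp: list_family_def split: if_splits)
    have card: "card (set u) = Suc m" using u d(1) m by (simp add: tuples_def distinct_card)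
    then have ne: "set u \<noteq> {}" by auto
    have c: "?c \<in> set u" using ne by simp
    \<comment> \<open>For the order \<open>lt\<close>, the stage that introduces a set is its
      maximum, so the stagewise bound is the required one.\<close>
    have "set u - {?c} \<subseteq> {..<?c}" using Max_ge[of "set u"] by (auto simp: order.order_iff_strict)
    then have "set u - {?c} \<in> fsub {..<?c} m" using card c by (simp add: fsub_def)
    moreover have "insert ?c (set u - {?c}) = set u" using c by auto
    ultimately have "z \<in> hull (witness_sets e) {..<?c}" using \<Phi>_supp d(2) by metis
    then show "z \<in> (\<Union>w\<in>Fn_plus (UNIV \<inter> {..<?c}). e w)" 
      using hull_witness_sets[of e "{..<?c}"] by (simp add: subset_iff)
  qed
  moreover have "\<not> trivial_family UNIV x n (list_family \<Phi>)"
    using triv_if_trivial_list_family \<Phi>(2) by blast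
  ultimately show ?thesis using coherent_list_family[OF \<Phi>(1)] by blast
qed

theorem theorem3p7:
  fixes n :: nat and x :: "'i::wellorder \<Rightarrow> 'a set"
  assumes "1 \<le> n"
    and "is_omega n {(\<alpha>, \<beta>). \<alpha> \<le> (\<beta> :: 'i)}"
    and "\<exists>h :: 'h::ab_group_add. h \<noteq> 0"
    and "ascending UNIV x"
  shows "(\<exists>\<Phi> :: 'i list \<Rightarrow> 'a \<Rightarrow> ('i \<Rightarrow>\<^sub>0 'h). coherent UNIV x n \<Phi> \<and> \<not> trivial_family UNIV x n \<Phi>)
    \<and> (\<forall>e C. witness_ascending UNIV x e C \<longrightarrow>
         (\<exists>\<Phi> :: 'i list \<Rightarrow> 'a \<Rightarrow> ('i \<Rightarrow>\<^sub>0 'h). coherent UNIV x n \<Phi> \<and> \<not> trivial_family UNIV x n \<Phi>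
           \<and> supported_on UNIV x n e \<Phi>))"
proof -
  obtain h :: 'h where "h \<noteq> 0" using assms(3) by blast
  note * = supported_family[OF assms(1,2) this]
  obtain e C where "witness_ascending UNIV x e C" using assms(4) by (auto simp: ascending_def)
  then show ?thesis using * by blast
qed

end
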